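(* Let $\mathcal{O}(a)$ be a regular spherical octahedron in $\mathbb{S}^3$ with all edge lengths equal to $a$ and all dihedral angles equal to $A$. Then its volume $V=\mathrm{vol}(\mathcal{O}(a))$ is given by either of the following formulae: \begin{align*} V&=6\int_{\arccos(-\frac{1}{3})}^A \arccos\left(-\frac{\cos\varphi+1}{2\cos\varphi}\right)\,d\varphi,\\ V&=\int_{0}^a \frac{6\,t\sin t\,dt}{(1+2\cos t)\sqrt{\cos t\,(1+\cos t)}}. \end{align*}
   Context: $\mathbb{S}^3$ is the three-dimensional spherical space of constant curvature $1$ (the unit sphere in $\mathbb{R}^4$ with its intrinsic metric and volume). A regular spherical octahedron is a (non-degenerate) convex polyhedron in $\mathbb{S}^3$ of the combinatorial type of the octahedron, whose eight faces are congruent regular spherical triangles and whose dihedral angles (interior angles between adjacent faces) are all equal. *)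

theory Defs
  imports "HOL-Analysis.Analysis"
begin

type_synonym point = "real ^ 4"

abbreviation S3 :: "point set" where
  "S3 \<equiv> sphere 0 1"

definition sdist :: "point \<Rightarrow> point \<Rightarrow> real" where
  "sdist p q = arccos (p \<bullet> q)"

(* In polar coordinates Lebesgue measure on R^4 is r^3 dr times the volume element of S3,
   so the cone over X inside the unit ball has measure vol(X) / 4. *)
definition svol :: "point set \<Rightarrow> real" where
  "svol X = 4 * measure lebesgue {t *\<^sub>R x | t x. t \<in> {0..1} \<and> x \<in> X}"

lemma svol_S3: "svol S3 = 2 * pi\<^sup>2"
proof -
  have *: "x \<in> {t *\<^sub>R x | t x. t \<in> {0..1} \<and> x \<in> S3}" if "norm x \<le> 1" for x :: point
  proof (cases "x = 0")
    case True
    then have "x = 0 *\<^sub>R axis 1 1" by simp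
    moreover have "axis 1 1 \<in> S3" by (simp add: norm_axis_1)
    ultimately show ?thesis
      by (intro CollectI exI[of _ 0] exI[of _ "axis 1 1"]) simp
  next
    case False
    then have "x = norm x *\<^sub>R (x /\<^sub>R norm x)" "x /\<^sub>R norm x \<in> S3" by auto
    with that show ?thesis
      by (intro CollectI exI[of _ "norm x"] exI[of _ "x /\<^sub>R norm x"]) simp
  qed
  have "{t *\<^sub>R x | t x. t \<in> {0..1} \<and> x \<in> S3} = cball 0 1"
  proof (intro equalityI subsetI)
    fix y :: point
    assume "y \<in> {t *\<^sub>R x | t x. t \<in> {0..1} \<and> x \<in> S3}"
    then show "y \<in> cball 0 1" by auto
  next
    fix y :: point
    assume "y \<in> cball 0 1"
    then have "norm y \<le> 1" by simp
    then show "y \<in> {t *\<^sub>R x | t x. t \<in> {0..1} \<and> x \<in> S3}"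
      by (rule *)
  qed
  then show ?thesis
    by (simp add: svol_def content_cball eval_unit_ball_vol)
qed

lemma svol_orthogonal_image:
  assumes "orthogonal_transformation h"
    and "{t *\<^sub>R x | t x. t \<in> {0..1} \<and> x \<in> X} \<in> lmeasurable"
  shows "svol (h ` X) = svol X"
proof -
  have h: "h (t *\<^sub>R x) = t *\<^sub>R h x" for t x
    using assms(1) by (simp add: orthogonal_transformation_def linear_scale)
  have "{t *\<^sub>R x | t x. t \<in> {0..1} \<and> x \<in> h ` X} = h ` {t *\<^sub>R x | t x. t \<in> {0..1} \<and> x \<in> X}"
  proof (intro equalityI subsetI)
    fix y
    assume "y \<in> {t *\<^sub>R x | t x. t \<in> {0..1} \<and> x \<in> h ` X}"
    then obtain t x where "y = t *\<^sub>R h x" "t \<in> {0..1}" "x \<in> X" by blast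
    then have "y = h (t *\<^sub>R x)" "t \<in> {0..1}" "x \<in> X" by (simp_all only: h)
    then show "y \<in> h ` {t *\<^sub>R x | t x. t \<in> {0..1} \<and> x \<in> X}" by blast
  next
    fix y
    assume "y \<in> h ` {t *\<^sub>R x | t x. t \<in> {0..1} \<and> x \<in> X}"
    then obtain t x where "y = h (t *\<^sub>R x)" "t \<in> {0..1}" "x \<in> X" by blast
    then have "y = t *\<^sub>R h x" "t \<in> {0..1}" "x \<in> X" by (simp_all only: h)
    then show "y \<in> {t *\<^sub>R x | t x. t \<in> {0..1} \<and> x \<in> h ` X}" by blast
  qed
  then show ?thesis
    by (simp only: svol_def measure_orthogonal_image[OF assms])
qed

definition shemisphere :: "point \<Rightarrow> point set" where
  "shemisphere u = {x \<in> S3. u \<bullet> x \<ge> 0}"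

definition great_sphere :: "point \<Rightarrow> point set" where
  "great_sphere u = {x \<in> S3. u \<bullet> x = 0}"

definition convex_spherical_polyhedron :: "point set \<Rightarrow> bool" where
  "convex_spherical_polyhedron P \<longleftrightarrow>
     (\<exists>U. finite U \<and> U \<subseteq> S3 \<and> P = S3 \<inter> (\<Inter>u\<in>U. shemisphere u)) \<and>
     (\<forall>x\<in>P. - x \<notin> P) \<and>
     top_of_set S3 interior_of P \<noteq> {}"

definition spherical_face :: "point set \<Rightarrow> point set \<Rightarrow> bool" where
  "spherical_face P F \<longleftrightarrow> (\<exists>u\<in>S3. P \<subseteq> shemisphere u \<and> F = P \<inter> great_sphere u)"

(* The library constant dim is the linear dimension of the span in R^4,
   one more than the spherical dimension. *)
definition vertices :: "point set \<Rightarrow> point set" where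
  "vertices P = {p. spherical_face P {p}}"

definition edges :: "point set \<Rightarrow> point set set" where
  "edges P = {E. spherical_face P E \<and> dim E = 2}"

definition facets :: "point set \<Rightarrow> point set set" where
  "facets P = {F. spherical_face P F \<and> dim F = 3}"

(* The vertices v(i,True), v(i,False) are the opposite ones, as +e_i, -e_i in the
   standard octahedron; edges join non-opposite vertices, and each facet
   takes one vertex from every opposite pair. *)
definition octahedral_type :: "point set \<Rightarrow> bool" where
  "octahedral_type P \<longleftrightarrow>
     (\<exists>v :: 3 \<times> bool \<Rightarrow> point.
        inj v \<and> range v = vertices P \<and>
        (\<lambda>E. E \<inter> vertices P) ` edges P = {{v (i, s), v (j, t)} | i j s t. i \<noteq> j} \<and>
        (\<lambda>F. F \<inter> vertices P) ` facets P = {range (\<lambda>i. v (i, s i)) | s. True})"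

definition vec_angle :: "point \<Rightarrow> point \<Rightarrow> real" where
  "vec_angle u w = arccos (u \<bullet> w / (norm u * norm w))"

(* q - (p \<bullet> q) p is the tangent direction at p of the great arc from p to q. *)
definition corner_angle :: "point \<Rightarrow> point \<Rightarrow> point \<Rightarrow> real" where
  "corner_angle p q r = vec_angle (q - (p \<bullet> q) *\<^sub>R p) (r - (p \<bullet> r) *\<^sub>R p)"

definition regular_spherical_triangle :: "point set \<Rightarrow> bool" where
  "regular_spherical_triangle F \<longleftrightarrow>
     (\<exists>p q r. {p, q, r} \<subseteq> S3 \<and> card {p, q, r} = 3 \<and> independent {p, q, r} \<and>
        F = S3 \<inter> convex_cone hull {p, q, r} \<and>
        sdist p q = sdist q r \<and> sdist q r = sdist r p \<and>
        corner_angle p q r = corner_angle q r p \<and> corner_angle q r p = corner_angle r p q)"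

(* The isometries of S3 are the restrictions of the orthogonal maps of R^4. *)
definition spherically_congruent :: "point set \<Rightarrow> point set \<Rightarrow> bool" where
  "spherically_congruent X Y \<longleftrightarrow> (\<exists>h. orthogonal_transformation h \<and> h ` X = Y)"

(* At every point of the edge E this is the unit tangent vector that is tangent to the
   facet F, perpendicular to E, and points into F. *)
definition inward_conormal :: "point set \<Rightarrow> point set \<Rightarrow> point" where
  "inward_conormal E F =
     (THE w. norm w = 1 \<and> w \<in> span F \<and> (\<forall>x\<in>E. w \<bullet> x = 0) \<and> (\<forall>x\<in>F. w \<bullet> x \<ge> 0))"

definition dihedral_angle :: "point set \<Rightarrow> point set \<Rightarrow> point set \<Rightarrow> real" where
  "dihedral_angle E F G = vec_angle (inward_conormal E F) (inward_conormal E G)"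

definition all_dihedral_angles :: "point set \<Rightarrow> real \<Rightarrow> bool" where
  "all_dihedral_angles P A \<longleftrightarrow>
     (\<forall>E\<in>edges P. \<forall>F\<in>facets P. \<forall>G\<in>facets P.
        F \<noteq> G \<and> E \<subseteq> F \<inter> G \<longrightarrow> dihedral_angle E F G = A)"

definition all_edge_lengths :: "point set \<Rightarrow> real \<Rightarrow> bool" where
  "all_edge_lengths P a \<longleftrightarrow>
     (\<forall>E\<in>edges P. \<forall>p\<in>E \<inter> vertices P. \<forall>q\<in>E \<inter> vertices P. p \<noteq> q \<longrightarrow> sdist p q = a)"

definition regular_spherical_octahedron :: "point set \<Rightarrow> bool" where
  "regular_spherical_octahedron P \<longleftrightarrow>
     convex_spherical_polyhedron P \<and> octahedral_type P \<and>
     (\<forall>F\<in>facets P. regular_spherical_triangle F) \<and>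
     (\<forall>F\<in>facets P. \<forall>G\<in>facets P. spherically_congruent F G) \<and>
     (\<exists>A. all_dihedral_angles P A)"

end

theory Submission
  imports Defs
begin

text \<open>
  Both formulas say that the volume has differential \<open>6 * t\<close> times the differential of the dihedral angle, where \<open>t\<close> is
  the edge length: this is Schlaefli's formula for twelve edges. The proof does not assume it but computes the volume.

  The shape comes first. Since any two vertices from different opposite pairs have inner product \<open>cos a\<close>,
  linear algebra in dimension four puts the vertices at \<open>\<mu> *\<^sub>R (n \<plusminus> R *\<^sub>R e i)\<close> for an orthonormal
  frame (\<open>opposite_pairs_frame\<close>), where \<open>\<mu>\<^sup>2 = cos a\<close> and \<open>1 + R\<^sup>2 = 1 / cos a\<close>. The normals of the eight facets are
  then known (\<open>facet_halfspace\<close>), so the polyhedron lies in the region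
  \<open>\<bar>x \<bullet> e 1\<bar> + \<bar>x \<bullet> e 2\<bar> + \<bar>x \<bullet> e 3\<bar> \<le> R * (x \<bullet> n)\<close> of the sphere; by convexity it fills that region
  (\<open>octahedral_region_subset_hemisphere\<close>). Explicit conormals along one edge give
  \<open>cos A = - 1 / (1 + 2 * cos a)\<close> (\<open>inward_conormal_eq\<close>, \<open>dihedral_angle_value\<close>).

  For the volume, the reflections of the octahedron divide the cone over this region into 48 congruent cones
  over orthoschemes (\<open>measure_chamber\<close>, \<open>measure_octahedral_cone\<close>). The measure of one such cone is an
  iterated integral. Dividing every coordinate by its predecessor makes the domain a box up to the
  radial bound, and three integrations are elementary; there remains an integral over the inradius of the projected
  octahedron (\<open>emeasure_orthoscheme_cone\<close>). The remaining integrand contains half of the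
  edge length as an arc tangent, and substituting the edge length for the inradius gives the second formula
  (\<open>integral_orthoscheme_density\<close>). Substituting the dihedral angle for the edge length gives the first one
  (\<open>integral_over_dihedral_angle\<close>).
\<close>

section \<open>Iterated integrals on four-dimensional space\<close>

text \<open>
  A vector given by its list of coordinates, so that functions on the space can be integrated one real
  variable at a time.
\<close>
definition vec4 :: "real \<Rightarrow> real \<Rightarrow> real \<Rightarrow> real \<Rightarrow> real ^ 4" where
  "vec4 w p q t = (\<chi> i. if i = 1 then w else if i = 2 then p else if i = 3 then q else t)"

lemma vec4_nth [simp]:
  "vec4 w p q t $ 1 = w" "vec4 w p q t $ 2 = p" "vec4 w p q t $ 3 = q" "vec4 w p q t $ 4 = t"
  by (simp_all add: vec4_def)

lemma borel_measurable_vec4 [measurable]: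
  "(\<lambda>(w, p, q, t). vec4 w p q t) \<in> borel_measurable borel"
proof -
  have "continuous_on UNIV (\<lambda>x. if i = (1::4) then fst x else if i = 2 then fst (snd x)
    else if i = 3 then fst (snd (snd x)) else snd (snd (snd x)) :: real)" for i
    by (cases "i = 1"; cases "i = 2"; cases "i = 3") (auto intro!: continuous_intros)
  then have "continuous_on UNIV (\<lambda>(w, p, q, t). vec4 w p q t)"
    unfolding vec4_def case_prod_unfold by (intro continuous_on_vec_lambda)
  then show ?thesis
    by (rule borel_measurable_continuous_onI)
qed

lemma prod_Basis_vec4:
  "(\<Prod>b\<in>Basis. (x :: real ^ 4) \<bullet> b) = x $ 1 * x $ 2 * x $ 3 * x $ 4"
proof -
  have B: "(Basis :: (real ^ 4) set) = range (\<lambda>i. axis i 1)"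
    unfolding Basis_vec_def by auto
  have inj: "inj (\<lambda>i::4. axis i (1::real))"
    by (simp add: inj_on_def axis_eq_axis)
  have "(\<Prod>b\<in>Basis. x \<bullet> b) = (\<Prod>i\<in>UNIV. x $ i)"
    unfolding B prod.reindex[OF inj] by (simp add: inner_axis)
  also have "\<dots> = x $ 1 * x $ 2 * x $ 3 * x $ 4"
    unfolding UNIV_4 by (simp add: mult.assoc)
  finally show ?thesis .
qed

text \<open>
  Lebesgue measure is characterised by its values on boxes, and the preimage of a box under
  \<^const>\<open>vec4\<close> is a product of four intervals.
\<close>
lemma lborel_vec4: "lborel = distr lborel borel (\<lambda>(w, p, q, t). vec4 w p q t)"
proof (rule lborel_eqI)
  fix l u :: "real ^ 4"
  assume lu: "\<And>b. b \<in> Basis \<Longrightarrow> l \<bullet> b \<le> u \<bullet> b"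
  have lu': "l $ i \<le> u $ i" for i
    using lu[of "axis i 1"] by (simp add: inner_axis)
  have *: "(\<lambda>(w, p, q, t). vec4 w p q t) -` box l u =
     {l$1<..<u$1} \<times> {l$2<..<u$2} \<times> {l$3<..<u$3} \<times> {l$4<..<u$4}"
    by (auto simp: mem_box_cart forall_4)
  have "emeasure lborel ({l$1<..<u$1} \<times> {l$2<..<u$2} \<times> {l$3<..<u$3} \<times> {l$4<..<u$4})
      = ennreal ((u$1 - l$1) * (u$2 - l$2) * (u$3 - l$3) * (u$4 - l$4))"
  proof -
    have 1: "emeasure lborel (A \<times> B) = emeasure lborel A * emeasure lborel B"
      if "A \<in> sets borel" "B \<in> sets borel" for A :: "'a :: euclidean_space set" and B :: "'b :: euclidean_space set"
      using lborel.emeasure_pair_measure_Times[of A lborel B] that unfolding lborel_prod by simp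
    show ?thesis
      using lu' by (simp add: 1 borel_Times ennreal_mult mult.assoc)
  qed
  moreover have "emeasure (distr lborel borel (\<lambda>(w, p, q, t). vec4 w p q t)) (box l u) =
      emeasure lborel ((\<lambda>(w, p, q, t). vec4 w p q t) -` box l u \<inter> space lborel)"
  proof (rule emeasure_distr)
    show "(\<lambda>(w, p, q, t). vec4 w p q t) \<in> measurable lborel borel"
      using borel_measurable_vec4 by simp
    show "box l u \<in> sets borel" by (rule borel_open) (rule open_box)
  qed
  ultimately show "emeasure (distr lborel borel (\<lambda>(w, p, q, t). vec4 w p q t)) (box l u)
      = ennreal (\<Prod>b\<in>Basis. (u - l) \<bullet> b)"
    by (simp only: * space_lborel space_borel Int_UNIV_right prod_Basis_vec4 vector_minus_component)
qed simp

lemma nn_integral_lborel_prod: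
  fixes f :: "'a :: euclidean_space \<times> 'b :: euclidean_space \<Rightarrow> ennreal"
  assumes "f \<in> borel_measurable borel"
  shows "(\<integral>\<^sup>+x. f x \<partial>lborel) = (\<integral>\<^sup>+x. \<integral>\<^sup>+y. f (x, y) \<partial>lborel \<partial>lborel)"
proof -
  have "f \<in> borel_measurable (lborel \<Otimes>\<^sub>M lborel)"
    unfolding lborel_prod using assms by simp
  from lborel.nn_integral_fst[OF this] show ?thesis
    unfolding lborel_prod by simp
qed

lemma nn_integral_vec4:
  assumes f: "f \<in> borel_measurable borel"
  shows "(\<integral>\<^sup>+x. f x \<partial>lborel) =
    (\<integral>\<^sup>+w. \<integral>\<^sup>+p. \<integral>\<^sup>+q. \<integral>\<^sup>+t. f (vec4 w p q t) \<partial>lborel \<partial>lborel \<partial>lborel \<partial>lborel)"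
proof -
  have m: "(\<lambda>x. f (case x of (w, p, q, t) \<Rightarrow> vec4 w p q t)) \<in> borel_measurable borel"
    by (rule measurable_compose[OF borel_measurable_vec4 f])
  have "(\<integral>\<^sup>+x. f x \<partial>lborel) = (\<integral>\<^sup>+x. f x \<partial>distr lborel borel (\<lambda>(w, p, q, t). vec4 w p q t))"
    by (rule arg_cong[OF lborel_vec4, of "\<lambda>M. integral\<^sup>N M f"])
  also have "\<dots> = (\<integral>\<^sup>+x. f (case x of (w, p, q, t) \<Rightarrow> vec4 w p q t) \<partial>lborel)"
    by (rule nn_integral_distr) (use f borel_measurable_vec4 in simp_all)
  also have "\<dots> = (\<integral>\<^sup>+w. \<integral>\<^sup>+p. \<integral>\<^sup>+q. \<integral>\<^sup>+t. f (vec4 w p q t) \<partial>lborel \<partial>lborel \<partial>lborel \<partial>lborel)"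
  proof -
    have [measurable]: "case_prod (\<lambda>w (p, q, t). f (vec4 w p q t)) \<in> borel_measurable borel"
      using m by (simp add: case_prod_unfold)
    have 1: "(\<lambda>(p, q, t). f (vec4 w p q t)) \<in> borel_measurable borel" for w
      using measurable_compose[of "Pair w" borel borel, OF _ m] by (simp add: case_prod_unfold)
    have 2: "(\<lambda>(q, t). f (vec4 w p q t)) \<in> borel_measurable borel" for w p
      using measurable_compose[of "Pair p" borel borel, OF _ 1[of w]] by (simp add: case_prod_unfold)
    show ?thesis
      using m 1 2 by (simp add: nn_integral_lborel_prod case_prod_unfold)
  qed
  finally show ?thesis .
qed

section \<open>Measure of the cone over an orthoscheme\<close>

text \<open>
  The reflections that fix a regular octahedron cut it into 48 congruent orthoschemes with
  vertices the centre, a face centre, the midpoint of an edge of that face, and an end of that edge.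
  In coordinates adapted to these mutually perpendicular steps (first the axis through the centre, then
  the three steps in order), this is the cone over one of them, cut off by the unit ball. The slopes
  \<open>1 / sqrt 2\<close> and \<open>sqrt 3\<close> are ratios of consecutive steps in the Euclidean octahedron that appears under
  central projection; only the inradius \<open>\<rho>\<close> of that octahedron varies.
\<close>
definition orthoscheme_cone :: "real \<Rightarrow> (real ^ 4) set" where
  "orthoscheme_cone \<rho> = {x. norm x \<le> 1 \<and> 0 \<le> x $ 4 \<and> x $ 4 \<le> sqrt 3 * x $ 3 \<and>
     sqrt 2 * x $ 3 \<le> x $ 2 \<and> x $ 2 \<le> \<rho> * x $ 1}"

text \<open>
  The derivative of the volume of the cone with respect to \<open>\<rho>\<close>: up to the factor 1/4, the integral of
  \<open>(1 + norm x ^ 2) powr -2\<close> over the right triangle that is the slice of the projected orthoscheme at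
  distance \<open>p\<close> from the centre. The arc tangent in it will turn out to be half of an edge length.
\<close>
definition orthoscheme_density :: "real \<Rightarrow> real" where
  "orthoscheme_density p =
     p * arctan (sqrt 3 * p / sqrt (2 + 3 * p\<^sup>2)) / (8 * (1 + p\<^sup>2) * sqrt (2 + 3 * p\<^sup>2))"

lemma nn_integral_scale:
  fixes c :: real
  assumes "f \<in> borel_measurable borel" "c \<noteq> 0"
  shows "(\<integral>\<^sup>+x. f x \<partial>lborel) = ennreal \<bar>c\<bar> * (\<integral>\<^sup>+x. f (c * x) \<partial>lborel)"
  using nn_integral_real_affine[OF assms, of 0] by simp

lemma nn_integral_cong_nonzero:
  assumes "\<And>x::real. x \<noteq> 0 \<Longrightarrow> f x = g x"
  shows "(\<integral>\<^sup>+x. f x \<partial>lborel) = (\<integral>\<^sup>+x. g x \<partial>lborel)"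
proof (rule nn_integral_cong_AE)
  show "AE x in lborel. f x = g x"
    using AE_lborel_singleton[of "0::real"] by eventually_elim (rule assms)
qed

text \<open>
  Lets the measurability prover handle an abstract curried integrand with its arguments in any order.
\<close>
lemma borel_measurable_curry4:
  assumes "(\<lambda>(w, p, q, t). f w p q t) \<in> borel_measurable (borel \<Otimes>\<^sub>M borel \<Otimes>\<^sub>M borel \<Otimes>\<^sub>M borel)"
    and [measurable]: "a \<in> borel_measurable M" "b \<in> borel_measurable M" "c \<in> borel_measurable M" "d \<in> borel_measurable M"
  shows "(\<lambda>x. f (a x) (b x) (c x) (d x)) \<in> borel_measurable M"
proof -
  have "(\<lambda>x. (a x, b x, c x, d x)) \<in> measurable M (borel \<Otimes>\<^sub>M borel \<Otimes>\<^sub>M borel \<Otimes>\<^sub>M borel)"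
    by measurable
  from measurable_compose[OF this assms(1)] show ?thesis by simp
qed

text \<open>
  Each variable is replaced by its ratio to the preceding one. This turns a cone whose inequalities
  relate only consecutive coordinates into a box; a coordinate that vanishes is a null set.
\<close>
lemma nn_integral_iterated_scale:
  fixes f :: "real \<Rightarrow> real \<Rightarrow> real \<Rightarrow> real \<Rightarrow> ennreal"
  assumes f: "(\<lambda>(w, p, q, t). f w p q t) \<in> borel_measurable (borel \<Otimes>\<^sub>M borel \<Otimes>\<^sub>M borel \<Otimes>\<^sub>M borel)"
  shows "(\<integral>\<^sup>+w. \<integral>\<^sup>+p. \<integral>\<^sup>+q. \<integral>\<^sup>+t. f w p q t \<partial>lborel \<partial>lborel \<partial>lborel \<partial>lborel) =
    (\<integral>\<^sup>+w. \<integral>\<^sup>+p. \<integral>\<^sup>+q. \<integral>\<^sup>+t. ennreal (\<bar>w\<bar> ^ 3 * p\<^sup>2 * \<bar>q\<bar>) *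
       f w (w * p) (w * p * q) (w * p * q * t) \<partial>lborel \<partial>lborel \<partial>lborel \<partial>lborel)"
proof (rule nn_integral_cong_nonzero)
  note borel_measurable_curry4[OF f, measurable (raw)]
  fix w :: real assume w: "w \<noteq> 0"
  have "(\<integral>\<^sup>+p. \<integral>\<^sup>+q. \<integral>\<^sup>+t. f w p q t \<partial>lborel \<partial>lborel \<partial>lborel) =
     \<bar>w\<bar> * (\<integral>\<^sup>+p. \<integral>\<^sup>+q. \<integral>\<^sup>+t. f w (w * p) q t \<partial>lborel \<partial>lborel \<partial>lborel)"
    by (rule nn_integral_scale[OF _ w]) measurable
  also have "\<dots> = (\<integral>\<^sup>+p. \<bar>w\<bar> * (\<integral>\<^sup>+q. \<integral>\<^sup>+t. f w (w * p) q t \<partial>lborel \<partial>lborel) \<partial>lborel)"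
    by (rule nn_integral_cmult[symmetric]) measurable
  also have "\<dots> = (\<integral>\<^sup>+p. \<integral>\<^sup>+q. \<integral>\<^sup>+t. ennreal (\<bar>w\<bar> ^ 3 * p\<^sup>2 * \<bar>q\<bar>) *
       f w (w * p) (w * p * q) (w * p * q * t) \<partial>lborel \<partial>lborel \<partial>lborel)"
  proof (rule nn_integral_cong_nonzero)
    fix p :: real assume p: "p \<noteq> 0"
    with w have wp: "w * p \<noteq> 0" by simp
    have "(\<integral>\<^sup>+q. \<integral>\<^sup>+t. f w (w * p) q t \<partial>lborel \<partial>lborel) =
       \<bar>w * p\<bar> * (\<integral>\<^sup>+q. \<integral>\<^sup>+t. f w (w * p) (w * p * q) t \<partial>lborel \<partial>lborel)"
      by (rule nn_integral_scale[OF _ wp]) measurable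
    then have "\<bar>w\<bar> * (\<integral>\<^sup>+q. \<integral>\<^sup>+t. f w (w * p) q t \<partial>lborel \<partial>lborel) =
       ennreal (\<bar>w\<bar> * \<bar>w * p\<bar>) * (\<integral>\<^sup>+q. \<integral>\<^sup>+t. f w (w * p) (w * p * q) t \<partial>lborel \<partial>lborel)"
      by (simp add: ennreal_mult mult.assoc)
    also have "\<dots> = (\<integral>\<^sup>+q. ennreal (\<bar>w\<bar> * \<bar>w * p\<bar>) * (\<integral>\<^sup>+t. f w (w * p) (w * p * q) t \<partial>lborel) \<partial>lborel)"
      by (rule nn_integral_cmult[symmetric]) measurable
    also have "\<dots> = (\<integral>\<^sup>+q. \<integral>\<^sup>+t. ennreal (\<bar>w\<bar> ^ 3 * p\<^sup>2 * \<bar>q\<bar>) *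
       f w (w * p) (w * p * q) (w * p * q * t) \<partial>lborel \<partial>lborel)"
    proof (rule nn_integral_cong_nonzero)
      fix q :: real assume q: "q \<noteq> 0"
      with wp have wpq: "w * p * q \<noteq> 0" by simp
      have eq: "\<bar>w\<bar> * \<bar>w * p\<bar> * \<bar>w * p * q\<bar> = \<bar>w\<bar> ^ 3 * p\<^sup>2 * \<bar>q\<bar>"
      proof -
        have "p\<^sup>2 = \<bar>p\<bar> * \<bar>p\<bar>" by (simp add: power2_eq_square)
        then show ?thesis by (simp only: abs_mult power3_eq_cube mult_ac)
      qed
      have "(\<integral>\<^sup>+t. f w (w * p) (w * p * q) t \<partial>lborel) =
        \<bar>w * p * q\<bar> * (\<integral>\<^sup>+t. f w (w * p) (w * p * q) (w * p * q * t) \<partial>lborel)"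
        by (rule nn_integral_scale[OF _ wpq]) measurable
      then have "ennreal (\<bar>w\<bar> * \<bar>w * p\<bar>) * (\<integral>\<^sup>+t. f w (w * p) (w * p * q) t \<partial>lborel) =
         ennreal (\<bar>w\<bar> ^ 3 * p\<^sup>2 * \<bar>q\<bar>) * (\<integral>\<^sup>+t. f w (w * p) (w * p * q) (w * p * q * t) \<partial>lborel)"
        unfolding eq[symmetric] by (simp add: ennreal_mult mult.assoc)
      also have "\<dots> = (\<integral>\<^sup>+t. ennreal (\<bar>w\<bar> ^ 3 * p\<^sup>2 * \<bar>q\<bar>) *
         f w (w * p) (w * p * q) (w * p * q * t) \<partial>lborel)"
        by (rule nn_integral_cmult[symmetric]) measurable
      finally show "ennreal (\<bar>w\<bar> * \<bar>w * p\<bar>) * (\<integral>\<^sup>+t. f w (w * p) (w * p * q) t \<partial>lborel) = \<dots>" .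
    qed
    finally show "\<bar>w\<bar> * (\<integral>\<^sup>+q. \<integral>\<^sup>+t. f w (w * p) q t \<partial>lborel \<partial>lborel) = \<dots>" .
  qed
  finally show "(\<integral>\<^sup>+p. \<integral>\<^sup>+q. \<integral>\<^sup>+t. f w p q t \<partial>lborel \<partial>lborel \<partial>lborel) = \<dots>" .
qed

text \<open>
  The radial variable is moved innermost, since the ball bounds it in terms of all other variables.
  The last two variables are exchanged because integrating in \<open>q\<close> first keeps both primitives elementary.
\<close>
lemma nn_integral_rotate4:
  fixes f :: "real \<Rightarrow> real \<Rightarrow> real \<Rightarrow> real \<Rightarrow> ennreal"
  assumes f: "(\<lambda>(w, p, q, t). f w p q t) \<in> borel_measurable (borel \<Otimes>\<^sub>M borel \<Otimes>\<^sub>M borel \<Otimes>\<^sub>M borel)"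
  shows "(\<integral>\<^sup>+w. \<integral>\<^sup>+p. \<integral>\<^sup>+q. \<integral>\<^sup>+t. f w p q t \<partial>lborel \<partial>lborel \<partial>lborel \<partial>lborel) =
    (\<integral>\<^sup>+p. \<integral>\<^sup>+t. \<integral>\<^sup>+q. \<integral>\<^sup>+w. f w p q t \<partial>lborel \<partial>lborel \<partial>lborel \<partial>lborel)"
proof -
  note borel_measurable_curry4[OF f, measurable (raw)]
  have "(\<integral>\<^sup>+w. \<integral>\<^sup>+p. \<integral>\<^sup>+q. \<integral>\<^sup>+t. f w p q t \<partial>lborel \<partial>lborel \<partial>lborel \<partial>lborel) =
    (\<integral>\<^sup>+p. \<integral>\<^sup>+w. \<integral>\<^sup>+q. \<integral>\<^sup>+t. f w p q t \<partial>lborel \<partial>lborel \<partial>lborel \<partial>lborel)"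
    by (rule lborel_pair.Fubini') measurable
  also have "\<dots> = (\<integral>\<^sup>+p. \<integral>\<^sup>+q. \<integral>\<^sup>+w. \<integral>\<^sup>+t. f w p q t \<partial>lborel \<partial>lborel \<partial>lborel \<partial>lborel)"
    by (intro nn_integral_cong lborel_pair.Fubini') measurable
  also have "\<dots> = (\<integral>\<^sup>+p. \<integral>\<^sup>+q. \<integral>\<^sup>+t. \<integral>\<^sup>+w. f w p q t \<partial>lborel \<partial>lborel \<partial>lborel \<partial>lborel)"
    by (intro nn_integral_cong lborel_pair.Fubini') measurable
  also have "\<dots> = (\<integral>\<^sup>+p. \<integral>\<^sup>+t. \<integral>\<^sup>+q. \<integral>\<^sup>+w. f w p q t \<partial>lborel \<partial>lborel \<partial>lborel \<partial>lborel)"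
    by (intro nn_integral_cong lborel_pair.Fubini') measurable
  finally show ?thesis .
qed

text \<open>
  Integrating out the radius replaces the cone by its central projection to an affine hyperplane,
  with density \<open>1 / (4 * Q ^ 2)\<close>, where \<open>Q\<close> is the squared distance from the origin.
\<close>
lemma orthoscheme_radial_integral:
  fixes Q :: real
  assumes "Q > 0"
  shows "(\<integral>\<^sup>+w. ennreal (w ^ 3) * indicator {0..1 / sqrt Q} w \<partial>lborel) = ennreal (1 / (4 * Q\<^sup>2))"
proof -
  have "(\<integral>\<^sup>+w. ennreal (w ^ 3) * indicator {0..1 / sqrt Q} w \<partial>lborel) =
     ennreal ((1 / sqrt Q) ^ 4 / 4 - 0 ^ 4 / 4)"
    using assms by (intro nn_integral_FTC_Icc[where F = "\<lambda>w. w ^ 4 / 4"]) (auto intro!: derivative_eq_intros)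
  also have "(1 / sqrt Q) ^ 4 = 1 / Q\<^sup>2"
    using assms by (simp add: power_divide real_sqrt_power_even)
  finally show ?thesis by simp
qed

lemma orthoscheme_first_integral:
  fixes p t :: real
  shows "(\<integral>\<^sup>+q. ennreal (p\<^sup>2 * q * (1 / (4 * (1 + p\<^sup>2 * (1 + q\<^sup>2 * (1 + t\<^sup>2)))\<^sup>2))) * indicator {0..1 / sqrt 2} q \<partial>lborel) =
    ennreal (p\<^sup>2 / (8 * (1 + p\<^sup>2) * (2 + 3 * p\<^sup>2 + p\<^sup>2 * t\<^sup>2)))"
proof -
  \<comment> \<open>The denominator is affine in the square of the variable, which makes the integrand a derivative.\<close>
  define \<alpha> \<beta> where "\<alpha> = 1 + p\<^sup>2" and "\<beta> = p\<^sup>2 * (1 + t\<^sup>2)"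
  have pos: "\<alpha> > 0" "\<beta> \<ge> 0" "\<alpha> + \<beta> * q\<^sup>2 > 0" for q
    by (auto simp: \<alpha>_def \<beta>_def add_pos_nonneg)
  have ab: "1 + p\<^sup>2 * (1 + q\<^sup>2 * (1 + t\<^sup>2)) = \<alpha> + \<beta> * q\<^sup>2" for q
    by (simp add: \<alpha>_def \<beta>_def algebra_simps)
  have "(\<integral>\<^sup>+q. ennreal (p\<^sup>2 * q * (1 / (4 * (\<alpha> + \<beta> * q\<^sup>2)\<^sup>2))) * indicator {0..1 / sqrt 2} q \<partial>lborel) =
    ennreal (p\<^sup>2 * (1 / sqrt 2)\<^sup>2 / (8 * \<alpha> * (\<alpha> + \<beta> * (1 / sqrt 2)\<^sup>2)) - p\<^sup>2 * 0\<^sup>2 / (8 * \<alpha> * (\<alpha> + \<beta> * 0\<^sup>2)))"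
  proof (rule nn_integral_FTC_Icc[where F = "\<lambda>q. p\<^sup>2 * q\<^sup>2 / (8 * \<alpha> * (\<alpha> + \<beta> * q\<^sup>2))"])
    fix q :: real assume "q \<in> {0..1 / sqrt 2}"
    define D where "D = \<alpha> + \<beta> * q\<^sup>2"
    have D: "D \<noteq> 0" "\<alpha> \<noteq> 0" using pos(1) pos(3)[of q] by (auto simp: D_def)
    have "((\<lambda>q. p\<^sup>2 * q\<^sup>2 / (8 * \<alpha> * (\<alpha> + \<beta> * q\<^sup>2))) has_real_derivative
        (p\<^sup>2 * (2 * q) * (8 * \<alpha> * D) - p\<^sup>2 * q\<^sup>2 * (8 * \<alpha> * (\<beta> * (2 * q)))) / (8 * \<alpha> * D)\<^sup>2) (at q)"
      using D unfolding D_def by (auto intro!: derivative_eq_intros simp: power2_eq_square)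
    also have "(p\<^sup>2 * (2 * q) * (8 * \<alpha> * D) - p\<^sup>2 * q\<^sup>2 * (8 * \<alpha> * (\<beta> * (2 * q)))) =
        16 * p\<^sup>2 * q * \<alpha> * \<alpha>"
      unfolding D_def by (simp add: algebra_simps power2_eq_square)
    also have "16 * p\<^sup>2 * q * \<alpha> * \<alpha> / (8 * \<alpha> * D)\<^sup>2 = p\<^sup>2 * q * (1 / (4 * D\<^sup>2))"
      using D by (simp add: power_mult_distrib power2_eq_square)
    finally show "((\<lambda>q. p\<^sup>2 * q\<^sup>2 / (8 * \<alpha> * (\<alpha> + \<beta> * q\<^sup>2))) has_real_derivative
        p\<^sup>2 * q * (1 / (4 * (\<alpha> + \<beta> * q\<^sup>2)\<^sup>2))) (at q)"
      unfolding D_def .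
  qed (use pos in \<open>auto intro!: mult_nonneg_nonneg\<close>)
  also have "p\<^sup>2 * (1 / sqrt 2)\<^sup>2 / (8 * \<alpha> * (\<alpha> + \<beta> * (1 / sqrt 2)\<^sup>2)) - p\<^sup>2 * 0\<^sup>2 / (8 * \<alpha> * (\<alpha> + \<beta> * 0\<^sup>2)) =
     p\<^sup>2 / (8 * \<alpha> * (2 * \<alpha> + \<beta>))"
    using pos(1,2) by (simp add: power_divide divide_simps)
  also have "2 * \<alpha> + \<beta> = 2 + 3 * p\<^sup>2 + p\<^sup>2 * t\<^sup>2"
    by (simp add: \<alpha>_def \<beta>_def algebra_simps)
  finally show ?thesis unfolding ab by (simp add: \<alpha>_def)
qed

lemma orthoscheme_second_integral:
  fixes p :: real
  shows "(\<integral>\<^sup>+t. ennreal (p\<^sup>2 / (8 * (1 + p\<^sup>2) * (2 + 3 * p\<^sup>2 + p\<^sup>2 * t\<^sup>2))) * indicator {0..sqrt 3} t \<partial>lborel) =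
    ennreal (orthoscheme_density p)"
proof -
  define s where "s = sqrt (2 + 3 * p\<^sup>2)"
  have s: "s > 0" "s\<^sup>2 = 2 + 3 * p\<^sup>2"
    by (auto simp: s_def add_pos_nonneg)
  have p1: "1 + p\<^sup>2 > 0" by (simp add: add_pos_nonneg)
  have "(\<integral>\<^sup>+t. ennreal (p\<^sup>2 / (8 * (1 + p\<^sup>2) * (s\<^sup>2 + p\<^sup>2 * t\<^sup>2))) * indicator {0..sqrt 3} t \<partial>lborel) =
    ennreal (p / (8 * (1 + p\<^sup>2) * s) * arctan (p * sqrt 3 / s) - p / (8 * (1 + p\<^sup>2) * s) * arctan (p * 0 / s))"
  proof (rule nn_integral_FTC_Icc[where F = "\<lambda>t. p / (8 * (1 + p\<^sup>2) * s) * arctan (p * t / s)"])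
    fix t :: real
    have pos: "s\<^sup>2 + p\<^sup>2 * t\<^sup>2 > 0" using s by (simp add: add_pos_nonneg)
    have "((\<lambda>t. p / (8 * (1 + p\<^sup>2) * s) * arctan (p * t / s)) has_real_derivative
        p / (8 * (1 + p\<^sup>2) * s) * (p / s / (1 + (p * t / s)\<^sup>2))) (at t)"
    proof (rule DERIV_cmult)
      have "((\<lambda>t. p * t / s) has_real_derivative p / s) (at t)"
        using s(1) by (auto intro!: derivative_eq_intros)
      from DERIV_chain2[OF DERIV_arctan this]
      show "((\<lambda>t. arctan (p * t / s)) has_real_derivative p / s / (1 + (p * t / s)\<^sup>2)) (at t)"
        by (simp add: divide_inverse mult_ac)
    qed
    also have "p / s / (1 + (p * t / s)\<^sup>2) = p * s / (s\<^sup>2 + p\<^sup>2 * t\<^sup>2)"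
    proof -
      have "1 + (p * t / s)\<^sup>2 = (s\<^sup>2 + p\<^sup>2 * t\<^sup>2) / (s * s)"
        using s(1) by (simp add: power_divide power_mult_distrib add_divide_distrib power2_eq_square)
      then show ?thesis using s(1) by simp
    qed
    also have "p / (8 * (1 + p\<^sup>2) * s) * (p * s / (s\<^sup>2 + p\<^sup>2 * t\<^sup>2)) =
        p\<^sup>2 / (8 * (1 + p\<^sup>2) * (s\<^sup>2 + p\<^sup>2 * t\<^sup>2))"
      using s(1) by (simp add: power2_eq_square)
    finally show "((\<lambda>t. p / (8 * (1 + p\<^sup>2) * s) * arctan (p * t / s)) has_real_derivative
        p\<^sup>2 / (8 * (1 + p\<^sup>2) * (s\<^sup>2 + p\<^sup>2 * t\<^sup>2))) (at t)" .
    show "0 \<le> p\<^sup>2 / (8 * (1 + p\<^sup>2) * (s\<^sup>2 + p\<^sup>2 * t\<^sup>2))"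
      by simp
  qed auto
  then show ?thesis
    by (simp add: s(2) orthoscheme_density_def s_def mult_ac)
qed

lemma closed_orthoscheme_cone: "closed (orthoscheme_cone \<rho>)"
  unfolding orthoscheme_cone_def
  by (intro closed_Collect_conj closed_Collect_le continuous_intros)

lemma continuous_on_orthoscheme_density: "continuous_on S orthoscheme_density"
proof -
  have "8 * (1 + p\<^sup>2) * sqrt (2 + 3 * p\<^sup>2) \<noteq> 0" "sqrt (2 + 3 * p\<^sup>2) \<noteq> 0" for p :: real
  proof -
    have "2 + 3 * p\<^sup>2 > 0" "1 + p\<^sup>2 > 0" by (simp_all add: add_pos_nonneg)
    then show "8 * (1 + p\<^sup>2) * sqrt (2 + 3 * p\<^sup>2) \<noteq> 0" "sqrt (2 + 3 * p\<^sup>2) \<noteq> 0"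
      unfolding mult_eq_0_iff by auto
  qed
  then show ?thesis
    unfolding orthoscheme_density_def by (intro continuous_intros ballI)
qed

lemma orthoscheme_density_nonneg: "p \<ge> 0 \<Longrightarrow> orthoscheme_density p \<ge> 0"
  by (simp add: orthoscheme_density_def)

lemma norm_vec4: "norm (vec4 w p q t) = sqrt (w\<^sup>2 + p\<^sup>2 + q\<^sup>2 + t\<^sup>2)"
  by (simp add: norm_vec_def L2_set_def sum_4)

text \<open>
  In ratio coordinates the constraints decouple: all but the ball become constant bounds. The
  inequalities themselves force the signs, starting from the innermost one.
\<close>
lemma scaled_mem_orthoscheme_cone:
  assumes "w \<noteq> 0" "p \<noteq> 0" "q \<noteq> 0" "\<rho> > 0"
  shows "vec4 w (w * p) (w * p * q) (w * p * q * t) \<in> orthoscheme_cone \<rho> \<longleftrightarrow>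
    w \<in> {0..1 / sqrt (1 + p\<^sup>2 * (1 + q\<^sup>2 * (1 + t\<^sup>2)))} \<and> p \<in> {0..\<rho>} \<and> q \<in> {0..1 / sqrt 2} \<and> t \<in> {0..sqrt 3}"
proof -
  define Q where "Q = 1 + p\<^sup>2 * (1 + q\<^sup>2 * (1 + t\<^sup>2))"
  have Q: "Q > 0" by (simp add: Q_def add_pos_nonneg)
  have nrm: "norm (vec4 w (w * p) (w * p * q) (w * p * q * t)) = \<bar>w\<bar> * sqrt Q"
  proof -
    have "w\<^sup>2 + (w * p)\<^sup>2 + (w * p * q)\<^sup>2 + (w * p * q * t)\<^sup>2 = w\<^sup>2 * Q"
      by (simp add: Q_def power2_eq_square algebra_simps)
    then show ?thesis by (simp add: norm_vec4 real_sqrt_mult)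
  qed
  have iff_w: "\<bar>w\<bar> * sqrt Q \<le> 1 \<longleftrightarrow> w \<le> 1 / sqrt Q" if "w > 0"
    using that Q by (simp add: field_simps)
  have chain: "w > 0 \<and> p > 0 \<and> q > 0 \<and> t \<ge> 0"
    if "0 \<le> w * p * q * t" "w * p * q * t \<le> sqrt 3 * (w * p * q)" "sqrt 2 * (w * p * q) \<le> w * p" "w * p \<le> \<rho> * w"
  proof -
    have "0 \<le> sqrt 3 * (w * p * q)" using that by linarith
    then have 3: "w * p * q > 0" using assms by (simp add: zero_le_mult_iff less_le)
    then have "0 < sqrt 2 * (w * p * q)" by simp
    then have 2: "w * p > 0" using that by linarith
    then have "0 < \<rho> * w" using that by linarith
    then have 1: "w > 0" using assms by (simp add: zero_less_mult_iff)
    have "p > 0" using 1 2 by (simp add: zero_less_mult_iff)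
    moreover have "q > 0" using 2 3 by (rule zero_less_mult_pos[rotated])
    moreover have "t \<ge> 0" using 3 that by (simp add: zero_le_mult_iff)
    ultimately show ?thesis using 1 by simp
  qed
  have ineqs: "(0 \<le> w * p * q * t \<and> w * p * q * t \<le> sqrt 3 * (w * p * q) \<and> sqrt 2 * (w * p * q) \<le> w * p \<and> w * p \<le> \<rho> * w)
     \<longleftrightarrow> p \<le> \<rho> \<and> q \<le> 1 / sqrt 2 \<and> t \<le> sqrt 3"
    if pos: "w > 0" "p > 0" "q > 0" "t \<ge> 0"
  proof -
    have "w * p * q * t \<le> sqrt 3 * (w * p * q) \<longleftrightarrow> t \<le> sqrt 3"
      using pos by (simp add: mult.commute[of "sqrt 3"])
    moreover have "sqrt 2 * (w * p * q) \<le> w * p \<longleftrightarrow> q \<le> 1 / sqrt 2"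
    proof -
      have "sqrt 2 * (w * p * q) \<le> w * p \<longleftrightarrow> (w * p) * (sqrt 2 * q) \<le> (w * p) * 1"
        by (simp add: mult_ac)
      also have "\<dots> \<longleftrightarrow> sqrt 2 * q \<le> 1"
        using pos by (subst mult_le_cancel_left_pos) auto
      finally show ?thesis by (simp add: field_simps)
    qed
    moreover have "w * p \<le> \<rho> * w \<longleftrightarrow> p \<le> \<rho>"
      using pos by (simp add: mult.commute[of \<rho>])
    ultimately show ?thesis using pos by auto
  qed
  have mem: "vec4 w (w * p) (w * p * q) (w * p * q * t) \<in> orthoscheme_cone \<rho> \<longleftrightarrow> \<bar>w\<bar> * sqrt Q \<le> 1 \<and>
      0 \<le> w * p * q * t \<and> w * p * q * t \<le> sqrt 3 * (w * p * q) \<and> sqrt 2 * (w * p * q) \<le> w * p \<and> w * p \<le> \<rho> * w"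
    unfolding orthoscheme_cone_def mem_Collect_eq nrm vec4_nth ..
  show ?thesis
  proof (cases "w > 0 \<and> p > 0 \<and> q > 0 \<and> t \<ge> 0")
    case True
    then show ?thesis
      unfolding mem Q_def[symmetric] using ineqs iff_w by auto
  next
    case False
    then show ?thesis
      unfolding mem Q_def[symmetric] using chain assms(1-3) by auto
  qed
qed

text \<open>
  The cone is opened up by passing to ratios of consecutive coordinates, and then three of the four
  integrations are carried out by explicit primitives.
\<close>
lemma emeasure_orthoscheme_cone:
  assumes "\<rho> > 0"
  shows "emeasure lborel (orthoscheme_cone \<rho>) = ennreal (integral {0..\<rho>} orthoscheme_density)"
proof -
  define Q where "Q p q t = 1 + p\<^sup>2 * (1 + q\<^sup>2 * (1 + t\<^sup>2))" for p q t :: real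
  have Q: "Q p q t > 0" for p q t by (simp add: Q_def add_pos_nonneg)
  have [measurable]: "orthoscheme_cone \<rho> \<in> sets borel"
    using closed_orthoscheme_cone by (rule borel_closed)
  have m: "(\<lambda>(w, p, q, t). indicator (orthoscheme_cone \<rho>) (vec4 w p q t) :: ennreal)
     \<in> borel_measurable (borel \<Otimes>\<^sub>M borel \<Otimes>\<^sub>M borel \<Otimes>\<^sub>M borel)"
  proof -
    have "(\<lambda>x. indicator (orthoscheme_cone \<rho>) (case x of (w, p, q, t) \<Rightarrow> vec4 w p q t) :: ennreal) \<in> borel_measurable borel"
      by (rule measurable_compose[OF borel_measurable_vec4]) measurable
    then show ?thesis by (simp add: borel_prod case_prod_unfold)
  qed
  \<comment> \<open>The integrand after scaling: the Jacobian, on a box of ratios and below the radial bound.\<close>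
  define h where "h w p q t = ennreal (w ^ 3 * (p\<^sup>2 * q)) * (indicator {0..1 / sqrt (Q p q t)} w *
     indicator {0..1 / sqrt 2} q * indicator {0..sqrt 3} t * indicator {0..\<rho>} p)" for w p q t :: real
  have mh: "(\<lambda>(w, p, q, t). h w p q t) \<in> borel_measurable (borel \<Otimes>\<^sub>M borel \<Otimes>\<^sub>M borel \<Otimes>\<^sub>M borel)"
  proof -
    have "(\<lambda>(w, p, q, t). h w p q t) = (\<lambda>x. case x of (w, p, q, t) \<Rightarrow> 
       if 0 \<le> w \<and> w \<le> 1 / sqrt (1 + p\<^sup>2 * (1 + q\<^sup>2 * (1 + t\<^sup>2))) \<and> 0 \<le> q \<and> q \<le> 1 / sqrt 2 \<and> 0 \<le> t \<and> t \<le> sqrt 3 \<and> 0 \<le> p \<and> p \<le> \<rho>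
       then ennreal (w ^ 3 * (p\<^sup>2 * q)) else 0)"
      by (auto simp: h_def fun_eq_iff Q_def indicator_def)
    then show ?thesis by simp
  qed
  have "emeasure lborel (orthoscheme_cone \<rho>) = (\<integral>\<^sup>+x. indicator (orthoscheme_cone \<rho>) x \<partial>lborel)"
    by simp
  also have "\<dots> = (\<integral>\<^sup>+w. \<integral>\<^sup>+p. \<integral>\<^sup>+q. \<integral>\<^sup>+t. indicator (orthoscheme_cone \<rho>) (vec4 w p q t) \<partial>lborel \<partial>lborel \<partial>lborel \<partial>lborel)"
    by (rule nn_integral_vec4) measurable
  also have "\<dots> = (\<integral>\<^sup>+w. \<integral>\<^sup>+p. \<integral>\<^sup>+q. \<integral>\<^sup>+t. ennreal (\<bar>w\<bar> ^ 3 * p\<^sup>2 * \<bar>q\<bar>) *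
       indicator (orthoscheme_cone \<rho>) (vec4 w (w * p) (w * p * q) (w * p * q * t)) \<partial>lborel \<partial>lborel \<partial>lborel \<partial>lborel)"
    by (rule nn_integral_iterated_scale[OF m])
  also have "\<dots> = (\<integral>\<^sup>+w. \<integral>\<^sup>+p. \<integral>\<^sup>+q. \<integral>\<^sup>+t. h w p q t \<partial>lborel \<partial>lborel \<partial>lborel \<partial>lborel)"
  proof (intro nn_integral_cong_nonzero nn_integral_cong)
    fix w p q t :: real
    assume nz: "w \<noteq> 0" "p \<noteq> 0" "q \<noteq> 0" "t \<noteq> 0"
    show "ennreal (\<bar>w\<bar> ^ 3 * p\<^sup>2 * \<bar>q\<bar>) *
       indicator (orthoscheme_cone \<rho>) (vec4 w (w * p) (w * p * q) (w * p * q * t)) = h w p q t"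
      using scaled_mem_orthoscheme_cone[OF nz(1-3) assms, of t]
      by (auto simp: h_def Q_def indicator_def mult.assoc)
  qed
  also have "\<dots> = (\<integral>\<^sup>+p. \<integral>\<^sup>+t. \<integral>\<^sup>+q. \<integral>\<^sup>+w. h w p q t \<partial>lborel \<partial>lborel \<partial>lborel \<partial>lborel)"
    by (rule nn_integral_rotate4[OF mh])
  also have "\<dots> = (\<integral>\<^sup>+p. ennreal (orthoscheme_density p) * indicator {0..\<rho>} p \<partial>lborel)"
  proof (rule nn_integral_cong)
    fix p :: real
    have w: "(\<integral>\<^sup>+w. h w p q t \<partial>lborel) = ennreal (p\<^sup>2 * q * (1 / (4 * (Q p q t)\<^sup>2))) * indicator {0..1 / sqrt 2} q *
        (indicator {0..sqrt 3} t * indicator {0..\<rho>} p)" for q t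
    proof (cases "q \<ge> 0")
      case True
      have "(\<integral>\<^sup>+w. h w p q t \<partial>lborel) = (\<integral>\<^sup>+w. (ennreal (p\<^sup>2 * q) * indicator {0..1 / sqrt 2} q * (indicator {0..sqrt 3} t * indicator {0..\<rho>} p)) *
          (ennreal (w ^ 3) * indicator {0..1 / sqrt (Q p q t)} w) \<partial>lborel)"
        by (intro nn_integral_cong) (use True in \<open>auto simp: h_def indicator_def ennreal_mult mult_ac\<close>)
      also have "\<dots> = (ennreal (p\<^sup>2 * q) * indicator {0..1 / sqrt 2} q * (indicator {0..sqrt 3} t * indicator {0..\<rho>} p)) *
          ennreal (1 / (4 * (Q p q t)\<^sup>2))"
        by (subst nn_integral_cmult) (simp_all only: orthoscheme_radial_integral[OF Q], measurable)
      also have "\<dots> = ennreal (p\<^sup>2 * q * (1 / (4 * (Q p q t)\<^sup>2))) * indicator {0..1 / sqrt 2} q *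
        (indicator {0..sqrt 3} t * indicator {0..\<rho>} p)"
        using True by (subst ennreal_mult) (simp_all add: mult_ac)
      finally show ?thesis .
    next
      case False
      then show ?thesis by (simp add: h_def)
    qed
    have q: "(\<integral>\<^sup>+q. \<integral>\<^sup>+w. h w p q t \<partial>lborel \<partial>lborel) =
        ennreal (p\<^sup>2 / (8 * (1 + p\<^sup>2) * (2 + 3 * p\<^sup>2 + p\<^sup>2 * t\<^sup>2))) * indicator {0..sqrt 3} t * indicator {0..\<rho>} p" for t
    proof -
      have "(\<integral>\<^sup>+q. \<integral>\<^sup>+w. h w p q t \<partial>lborel \<partial>lborel) =
        (\<integral>\<^sup>+q. ennreal (p\<^sup>2 * q * (1 / (4 * (Q p q t)\<^sup>2))) * indicator {0..1 / sqrt 2} q \<partial>lborel) *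
        (indicator {0..sqrt 3} t * indicator {0..\<rho>} p)"
        unfolding w Q_def by (rule nn_integral_multc) measurable
      then show ?thesis
        unfolding Q_def orthoscheme_first_integral by (simp only: mult.assoc)
    qed
    show "(\<integral>\<^sup>+t. \<integral>\<^sup>+q. \<integral>\<^sup>+w. h w p q t \<partial>lborel \<partial>lborel \<partial>lborel) = ennreal (orthoscheme_density p) * indicator {0..\<rho>} p"
      unfolding q by (subst nn_integral_multc) (simp_all only: orthoscheme_second_integral, measurable)
  qed
  also have "\<dots> = ennreal (integral {0..\<rho>} orthoscheme_density)"
    by (intro nn_integral_has_integral_lebesgue' integrable_integral integrable_continuous_interval
        continuous_on_orthoscheme_density) (simp add: orthoscheme_density_nonneg)
  finally show ?thesis .
qed

lemma measure_orthoscheme_cone: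
  assumes "\<rho> > 0"
  shows "measure lebesgue (orthoscheme_cone \<rho>) = integral {0..\<rho>} orthoscheme_density"
proof -
  have "integral {0..\<rho>} orthoscheme_density \<ge> 0"
    by (intro integral_nonneg integrable_continuous_interval continuous_on_orthoscheme_density)
       (simp add: orthoscheme_density_nonneg)
  moreover have "emeasure lebesgue (orthoscheme_cone \<rho>) = emeasure lborel (orthoscheme_cone \<rho>)"
    using closed_orthoscheme_cone[of \<rho>] by (simp add: borel_closed)
  ultimately show ?thesis
    by (simp add: measure_def emeasure_orthoscheme_cone[OF assms])
qed

section \<open>Decomposition of an octahedral cone into orthoscheme cones\<close>

text \<open>
  Four separate vectors instead of an indexed family, since frames are built by changing signs and
  by permuting their members.
\<close>
definition orthonormal_frame :: "point \<Rightarrow> point \<Rightarrow> point \<Rightarrow> point \<Rightarrow> bool" where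
  "orthonormal_frame a b c d \<longleftrightarrow>
     a \<bullet> a = 1 \<and> b \<bullet> b = 1 \<and> c \<bullet> c = 1 \<and> d \<bullet> d = 1 \<and>
     a \<bullet> b = 0 \<and> a \<bullet> c = 0 \<and> a \<bullet> d = 0 \<and> b \<bullet> c = 0 \<and> b \<bullet> d = 0 \<and> c \<bullet> d = 0"

lemma orthogonal_frame_coordinates:
  assumes "orthonormal_frame a b c d"
  shows "orthogonal_transformation (\<lambda>x. vec4 (x \<bullet> a) (x \<bullet> b) (x \<bullet> c) (x \<bullet> d))"
proof -
  define A :: "real ^ 4 ^ 4" where
    "A = (\<chi> i. if i = 1 then a else if i = 2 then b else if i = 3 then c else d)"
  have rows: "row 1 A = a" "row 2 A = b" "row 3 A = c" "row 4 A = d"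
    by (simp_all add: row_def A_def)
  have "orthogonal_matrix A"
    using assms unfolding orthogonal_matrix_orthonormal_rows orthonormal_frame_def
    by (simp add: forall_4 rows norm_eq_1 orthogonal_def inner_commute)
  then have "orthogonal_transformation (\<lambda>x. A *v x)"
    by (simp add: orthogonal_transformation_matrix)
  moreover have "A *v x = vec4 (x \<bullet> a) (x \<bullet> b) (x \<bullet> c) (x \<bullet> d)" for x
  proof -
    have "(A *v x) $ i = row i A \<bullet> x" for i
      by (simp add: matrix_vector_mult_def inner_vec_def row_def)
    then show ?thesis
      by (simp add: vec_eq_iff forall_4 rows inner_commute)
  qed
  ultimately show ?thesis by simp
qed

lemma bounded_cone_slice: "bounded {x :: 'a :: real_normed_vector. norm x \<le> 1 \<and> P x}"
  by (rule bounded_subset[OF bounded_cball[of 0 1]]) auto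

text \<open>
  The part in the unit ball of the cone over the octahedron in the hyperplane at height one above the
  origin, with centre \<open>n\<close> and vertices at distance \<open>R\<close> from the centre in the directions of \<open>a\<close>, \<open>b\<close>, \<open>c\<close>
  and their opposites.
\<close>
definition octahedral_cone :: "point \<Rightarrow> point \<Rightarrow> point \<Rightarrow> point \<Rightarrow> real \<Rightarrow> point set" where
  "octahedral_cone a b c n R = {x. norm x \<le> 1 \<and> \<bar>x \<bullet> a\<bar> + \<bar>x \<bullet> b\<bar> + \<bar>x \<bullet> c\<bar> \<le> R * (x \<bullet> n)}"

text \<open>
  A chamber of the reflection group generated by sign changes and permutations of \<open>a\<close>, \<open>b\<close>, \<open>c\<close>. In the
  orthonormal frame of the directions to the face centre, from there to the midpoint of an edge, and
  along that edge, it is the standard orthoscheme cone; hence its measure does not depend on the frame.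
\<close>
lemma measure_chamber:
  assumes "orthonormal_frame a b c n" "R > 0"
  shows "measure lebesgue {x \<in> octahedral_cone a b c n R. 0 \<le> x \<bullet> c \<and> x \<bullet> c \<le> x \<bullet> b \<and> x \<bullet> b \<le> x \<bullet> a} =
     integral {0..R / sqrt 3} orthoscheme_density" (is "measure _ ?C = _")
proof -
  \<comment> \<open>Directions of the three steps of the orthoscheme whose last vertex lies in direction a.\<close>
  define f g k where "f = (a + b + c) /\<^sub>R sqrt 3" and "g = (a + b - 2 *\<^sub>R c) /\<^sub>R sqrt 6" and "k = (a - b) /\<^sub>R sqrt 2"
  define h where "h x = vec4 (x \<bullet> n) (x \<bullet> f) (x \<bullet> g) (x \<bullet> k)" for x
  have sq: "sqrt 6 = sqrt 2 * sqrt 3"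
    by (simp flip: real_sqrt_mult)
  have "orthonormal_frame n f g k"
    using assms(1) unfolding orthonormal_frame_def f_def g_def k_def
    by (simp add: inner_simps inner_commute field_simps)
  then have orth: "orthogonal_transformation h"
    unfolding h_def by (rule orthogonal_frame_coordinates)
  have mem: "h x \<in> orthoscheme_cone (R / sqrt 3) \<longleftrightarrow> x \<in> ?C" for x
  proof -
    have "norm (h x) = norm x" using orth by (simp add: orthogonal_transformation_norm)
    moreover have "0 \<le> x \<bullet> k \<longleftrightarrow> x \<bullet> b \<le> x \<bullet> a"
      by (simp add: k_def inner_simps zero_le_mult_iff)
    moreover have "x \<bullet> k \<le> sqrt 3 * (x \<bullet> g) \<longleftrightarrow> x \<bullet> c \<le> x \<bullet> b"
    proof -
      have "sqrt 3 * (x \<bullet> g) = (x \<bullet> a + x \<bullet> b - 2 * (x \<bullet> c)) / sqrt 2"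
        by (simp add: g_def inner_simps sq divide_inverse)
      moreover have "x \<bullet> k = (x \<bullet> a - x \<bullet> b) / sqrt 2"
        by (simp add: k_def inner_simps divide_inverse)
      ultimately show ?thesis by (simp add: divide_le_cancel)
    qed
    moreover have "sqrt 2 * (x \<bullet> g) \<le> x \<bullet> f \<longleftrightarrow> 0 \<le> x \<bullet> c"
    proof -
      have "sqrt 2 * (x \<bullet> g) = (x \<bullet> a + x \<bullet> b - 2 * (x \<bullet> c)) / sqrt 3"
        by (simp add: g_def inner_simps sq divide_inverse)
      moreover have "x \<bullet> f = (x \<bullet> a + x \<bullet> b + x \<bullet> c) / sqrt 3"
        by (simp add: f_def inner_simps divide_inverse)
      ultimately show ?thesis by (simp add: divide_le_cancel)
    qed
    moreover have "x \<bullet> f \<le> R / sqrt 3 * (x \<bullet> n) \<longleftrightarrow> x \<bullet> a + x \<bullet> b + x \<bullet> c \<le> R * (x \<bullet> n)"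
    proof -
      have "x \<bullet> f = (x \<bullet> a + x \<bullet> b + x \<bullet> c) / sqrt 3"
        by (simp add: f_def inner_simps divide_inverse)
      then show ?thesis by (simp add: divide_le_cancel)
    qed
    ultimately show ?thesis
      unfolding orthoscheme_cone_def octahedral_cone_def mem_Collect_eq
      by (auto simp: h_def)
  qed
  have "h ` ?C = orthoscheme_cone (R / sqrt 3)"
    using mem orthogonal_transformation_surj[OF orth] by (auto simp: image_iff surj_def) metis
  moreover have "measure lebesgue (h ` ?C) = measure lebesgue ?C"
  proof (rule measure_orthogonal_image[OF orth])
    have "closed ?C"
      unfolding octahedral_cone_def mem_Collect_eq
      by (intro closed_Collect_conj closed_Collect_le continuous_intros)
    moreover have "bounded ?C"
      unfolding octahedral_cone_def mem_Collect_eq conj_assoc by (rule bounded_cone_slice)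
    ultimately show "?C \<in> lmeasurable"
      by (intro lmeasurable_compact) (simp add: compact_eq_bounded_closed)
  qed
  ultimately show ?thesis
    using assms(2) by (simp add: measure_orthoscheme_cone)
qed

lemma compact_halfspace_Int:
  fixes u :: "'a :: euclidean_space"
  assumes "compact S"
  shows "compact {x \<in> S. 0 \<le> x \<bullet> u}" "compact {x \<in> S. x \<bullet> u \<le> 0}"
proof -
  have "closed {x. 0 \<le> x \<bullet> u}" "closed {x. x \<bullet> u \<le> 0}"
    by (intro closed_Collect_le continuous_intros)+
  then show "compact {x \<in> S. 0 \<le> x \<bullet> u}" "compact {x \<in> S. x \<bullet> u \<le> 0}"
    using assms by (simp_all add: Collect_conj_eq compact_Int_closed)
qed

lemma measure_split_hyperplane:
  fixes u :: "'a :: euclidean_space"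
  assumes "compact S" "u \<noteq> 0"
  shows "measure lebesgue S = measure lebesgue {x \<in> S. 0 \<le> x \<bullet> u} + measure lebesgue {x \<in> S. x \<bullet> u \<le> 0}"
proof -
  have m: "{x \<in> S. 0 \<le> x \<bullet> u} \<in> lmeasurable" "{x \<in> S. x \<bullet> u \<le> 0} \<in> lmeasurable"
    using compact_halfspace_Int[OF assms(1)] by (simp_all add: lmeasurable_compact)
  have "negligible {x. u \<bullet> x = 0}" using assms(2) by (simp add: negligible_hyperplane)
  then have "negligible ({x \<in> S. 0 \<le> x \<bullet> u} \<inter> {x \<in> S. x \<bullet> u \<le> 0})"
    by (rule negligible_subset) (auto simp: inner_commute)
  then have "measure lebesgue ({x \<in> S. 0 \<le> x \<bullet> u} \<inter> {x \<in> S. x \<bullet> u \<le> 0}) = 0"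
    by (rule negligible_imp_measure0)
  with measure_Un3[OF m] have "measure lebesgue ({x \<in> S. 0 \<le> x \<bullet> u} \<union> {x \<in> S. x \<bullet> u \<le> 0}) =
      measure lebesgue {x \<in> S. 0 \<le> x \<bullet> u} + measure lebesgue {x \<in> S. x \<bullet> u \<le> 0}" by simp
  moreover have "{x \<in> S. 0 \<le> x \<bullet> u} \<union> {x \<in> S. x \<bullet> u \<le> 0} = S" by auto
  ultimately show ?thesis by simp
qed

lemma compact_octahedral_cone: "compact (octahedral_cone a b c n R)"
proof -
  have "closed (octahedral_cone a b c n R)"
    unfolding octahedral_cone_def by (intro closed_Collect_conj closed_Collect_le continuous_intros)
  then show ?thesis
    by (simp add: compact_eq_bounded_closed) (simp add: octahedral_cone_def bounded_cone_slice)
qed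

text \<open>
  Each of the three places that \<open>x \<bullet> c\<close> can take in the order \<open>x \<bullet> b \<le> x \<bullet> a\<close> gives a chamber for
  a permuted frame.
\<close>
lemma measure_octant_half:
  assumes "orthonormal_frame a b c n" "R > 0"
  shows "measure lebesgue {x \<in> octahedral_cone a b c n R. 0 \<le> x \<bullet> a \<and> 0 \<le> x \<bullet> b \<and> 0 \<le> x \<bullet> c \<and> 0 \<le> x \<bullet> (a - b)} =
    3 * integral {0..R / sqrt 3} orthoscheme_density" (is "measure _ ?S = 3 * ?I")
proof -
  have frames: "orthonormal_frame a c b n" "orthonormal_frame c a b n"
    using assms(1) by (auto simp: orthonormal_frame_def inner_commute)
  have "b \<bullet> c \<noteq> b \<bullet> b" "a \<bullet> c \<noteq> a \<bullet> a" using assms(1) by (simp_all add: orthonormal_frame_def)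
  then have ne: "b - c \<noteq> 0" "a - c \<noteq> 0" by auto
  have "compact ?S"
    using compact_halfspace_Int(1)[OF compact_halfspace_Int(1)[OF compact_halfspace_Int(1)[OF compact_halfspace_Int(1)
      [OF compact_octahedral_cone[of a b c n R], of a], of b], of c], of "a - b"]
    by (simp add: conj_assoc)
  note split1 = measure_split_hyperplane[OF this ne(1)]
  note split2 = measure_split_hyperplane[OF compact_halfspace_Int(2)[OF \<open>compact ?S\<close>, of "b - c"] ne(2)]
  have "{x \<in> ?S. 0 \<le> x \<bullet> (b - c)} =
      {x \<in> octahedral_cone a b c n R. 0 \<le> x \<bullet> c \<and> x \<bullet> c \<le> x \<bullet> b \<and> x \<bullet> b \<le> x \<bullet> a}"
    by (auto simp: inner_diff_right)
  then have 1: "measure lebesgue {x \<in> ?S. 0 \<le> x \<bullet> (b - c)} = ?I"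
    by (simp only: measure_chamber[OF assms])
  have "{x \<in> {x \<in> ?S. x \<bullet> (b - c) \<le> 0}. 0 \<le> x \<bullet> (a - c)} =
      {x \<in> octahedral_cone a c b n R. 0 \<le> x \<bullet> b \<and> x \<bullet> b \<le> x \<bullet> c \<and> x \<bullet> c \<le> x \<bullet> a}"
    by (auto simp: inner_diff_right octahedral_cone_def)
  then have 2: "measure lebesgue {x \<in> {x \<in> ?S. x \<bullet> (b - c) \<le> 0}. 0 \<le> x \<bullet> (a - c)} = ?I"
    by (simp only: measure_chamber[OF frames(1) assms(2)])
  have "{x \<in> {x \<in> ?S. x \<bullet> (b - c) \<le> 0}. x \<bullet> (a - c) \<le> 0} =
      {x \<in> octahedral_cone c a b n R. 0 \<le> x \<bullet> b \<and> x \<bullet> b \<le> x \<bullet> a \<and> x \<bullet> a \<le> x \<bullet> c}"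
    by (auto simp: inner_diff_right octahedral_cone_def)
  then have 3: "measure lebesgue {x \<in> {x \<in> ?S. x \<bullet> (b - c) \<le> 0}. x \<bullet> (a - c) \<le> 0} = ?I"
    by (simp only: measure_chamber[OF frames(2) assms(2)])
  show ?thesis
    using split1 split2 1 2 3 by linarith
qed

lemma measure_octant:
  assumes "orthonormal_frame a b c n" "R > 0"
  shows "measure lebesgue {x \<in> octahedral_cone a b c n R. 0 \<le> x \<bullet> a \<and> 0 \<le> x \<bullet> b \<and> 0 \<le> x \<bullet> c} =
    6 * integral {0..R / sqrt 3} orthoscheme_density" (is "measure _ ?S = 6 * ?I")
proof -
  have frame: "orthonormal_frame b a c n"
    using assms(1) by (auto simp: orthonormal_frame_def inner_commute)
  have "a \<bullet> b \<noteq> a \<bullet> a" using assms(1) by (simp add: orthonormal_frame_def)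
  then have ne: "a - b \<noteq> 0" by auto
  have "compact ?S"
    using compact_halfspace_Int(1)[OF compact_halfspace_Int(1)[OF compact_halfspace_Int(1)
      [OF compact_octahedral_cone[of a b c n R], of a], of b], of c]
    by (simp add: conj_assoc)
  from measure_split_hyperplane[OF this ne]
  have "measure lebesgue ?S = measure lebesgue {x \<in> ?S. 0 \<le> x \<bullet> (a - b)} + measure lebesgue {x \<in> ?S. x \<bullet> (a - b) \<le> 0}" .
  also have "{x \<in> ?S. 0 \<le> x \<bullet> (a - b)} =
      {x \<in> octahedral_cone a b c n R. 0 \<le> x \<bullet> a \<and> 0 \<le> x \<bullet> b \<and> 0 \<le> x \<bullet> c \<and> 0 \<le> x \<bullet> (a - b)}"
    by auto
  also have "{x \<in> ?S. x \<bullet> (a - b) \<le> 0} =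
      {x \<in> octahedral_cone b a c n R. 0 \<le> x \<bullet> b \<and> 0 \<le> x \<bullet> a \<and> 0 \<le> x \<bullet> c \<and> 0 \<le> x \<bullet> (b - a)}"
    by (auto simp: octahedral_cone_def inner_diff_right)
  finally show ?thesis
    using measure_octant_half[OF assms] measure_octant_half[OF frame assms(2)] by linarith
qed

lemma orthonormal_frame_minus:
  assumes "orthonormal_frame a b c n"
  shows "orthonormal_frame (- a) b c n" "orthonormal_frame a (- b) c n" "orthonormal_frame a b (- c) n"
  using assms by (simp_all add: orthonormal_frame_def)

lemma measure_octahedral_cone:
  assumes "orthonormal_frame a b c n" "R > 0"
  shows "measure lebesgue (octahedral_cone a b c n R) = 48 * integral {0..R / sqrt 3} orthoscheme_density"
    (is "_ = 48 * ?I")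
proof -
  have ne: "a \<noteq> 0" "b \<noteq> 0" "c \<noteq> 0" if "orthonormal_frame a b c n" for a b c
    using that by (auto simp: orthonormal_frame_def)
  have quarter: "measure lebesgue {x \<in> octahedral_cone a b c n R. 0 \<le> x \<bullet> a \<and> 0 \<le> x \<bullet> b} = 12 * ?I"
    if f: "orthonormal_frame a b c n" for a b c
  proof -
    let ?S = "{x \<in> octahedral_cone a b c n R. 0 \<le> x \<bullet> a \<and> 0 \<le> x \<bullet> b}"
    have "compact ?S"
      using compact_halfspace_Int(1)[OF compact_halfspace_Int(1)[OF compact_octahedral_cone[of a b c n R], of a], of b]
      by (simp add: conj_assoc)
    from measure_split_hyperplane[OF this ne(3)[OF f]]
    have "measure lebesgue ?S = measure lebesgue {x \<in> ?S. 0 \<le> x \<bullet> c} + measure lebesgue {x \<in> ?S. x \<bullet> c \<le> 0}" .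
    also have "{x \<in> ?S. 0 \<le> x \<bullet> c} = {x \<in> octahedral_cone a b c n R. 0 \<le> x \<bullet> a \<and> 0 \<le> x \<bullet> b \<and> 0 \<le> x \<bullet> c}"
      by auto
    also have "{x \<in> ?S. x \<bullet> c \<le> 0} = {x \<in> octahedral_cone a b (- c) n R. 0 \<le> x \<bullet> a \<and> 0 \<le> x \<bullet> b \<and> 0 \<le> x \<bullet> (- c)}"
      by (auto simp: octahedral_cone_def)
    finally show ?thesis
      using measure_octant[OF f assms(2)] measure_octant[OF orthonormal_frame_minus(3)[OF f] assms(2)] by linarith
  qed
  have half: "measure lebesgue {x \<in> octahedral_cone a b c n R. 0 \<le> x \<bullet> a} = 24 * ?I"
    if f: "orthonormal_frame a b c n" for a b c
  proof -
    let ?S = "{x \<in> octahedral_cone a b c n R. 0 \<le> x \<bullet> a}"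
    from measure_split_hyperplane[OF compact_halfspace_Int(1)[OF compact_octahedral_cone] ne(2)[OF f]]
    have "measure lebesgue ?S = measure lebesgue {x \<in> ?S. 0 \<le> x \<bullet> b} + measure lebesgue {x \<in> ?S. x \<bullet> b \<le> 0}" .
    also have "{x \<in> ?S. 0 \<le> x \<bullet> b} = {x \<in> octahedral_cone a b c n R. 0 \<le> x \<bullet> a \<and> 0 \<le> x \<bullet> b}"
      by auto
    also have "{x \<in> ?S. x \<bullet> b \<le> 0} = {x \<in> octahedral_cone a (- b) c n R. 0 \<le> x \<bullet> a \<and> 0 \<le> x \<bullet> (- b)}"
      by (auto simp: octahedral_cone_def)
    finally show ?thesis
      using quarter[OF f] quarter[OF orthonormal_frame_minus(2)[OF f]] by linarith
  qed
  from measure_split_hyperplane[OF compact_octahedral_cone ne(1)[OF assms(1)]]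
  have "measure lebesgue (octahedral_cone a b c n R) =
     measure lebesgue {x \<in> octahedral_cone a b c n R. 0 \<le> x \<bullet> a} + measure lebesgue {x \<in> octahedral_cone a b c n R. x \<bullet> a \<le> 0}" .
  also have "{x \<in> octahedral_cone a b c n R. x \<bullet> a \<le> 0} = {x \<in> octahedral_cone (- a) b c n R. 0 \<le> x \<bullet> (- a)}"
    by (auto simp: octahedral_cone_def)
  finally show ?thesis
    using half[OF assms(1)] half[OF orthonormal_frame_minus(1)[OF assms(1)]] by linarith
qed

section \<open>Edge length and dihedral angle as variables of integration\<close>

lemma arctan_sqrt_half_angle:
  assumes "0 \<le> t" "t < pi"
  shows "arctan (sqrt ((1 - cos t) / (1 + cos t))) = t / 2"
proof -
  have c: "cos (t / 2) > 0" using assms by (intro cos_gt_zero_pi) auto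
  have s: "sin (t / 2) \<ge> 0" using assms by (intro sin_ge_zero) auto
  have "cos t = 2 * (cos (t / 2))\<^sup>2 - 1"
    using cos_double_cos[of "t / 2"] by simp
  then have 1: "1 + cos t = 2 * (cos (t / 2))\<^sup>2" by simp
  have "cos t = 1 - 2 * (sin (t / 2))\<^sup>2"
    using cos_double_sin[of "t / 2"] by simp
  then have 2: "1 - cos t = 2 * (sin (t / 2))\<^sup>2" by simp
  have "sqrt ((1 - cos t) / (1 + cos t)) = sqrt ((tan (t / 2))\<^sup>2)"
    unfolding 1 2 by (simp add: tan_def power_divide)
  also have "\<dots> = tan (t / 2)"
    using c s by (simp add: tan_def)
  finally show ?thesis
    using assms by (simp add: arctan_tan)
qed

text \<open>
  With \<open>p\<close> the inradius of the projected octahedron of edge length \<open>t\<close>, the arc tangent in the density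
  is \<open>t / 2\<close> by the half-angle formula. The factor 192 is 48 orthoschemes times the factor 4 between the
  measure of a cone and the volume on the sphere.
\<close>
lemma orthoscheme_density_pullback:
  assumes t: "0 < t" "t < pi / 2"
  defines "p \<equiv> sqrt ((1 / cos t - 1) / 3)"
  shows "192 * (sin t / (6 * (cos t)\<^sup>2 * p) * orthoscheme_density p) =
     6 * t * sin t / ((1 + 2 * cos t) * sqrt (cos t * (1 + cos t)))"
proof -
  define c where "c = cos t"
  have c: "0 < c" using t by (simp add: c_def cos_gt_zero_pi)
  have "cos t < cos 0" using t by (intro cos_monotone_0_pi) auto
  then have c1: "c < 1" by (simp add: c_def)
  have pos: "1 / c - 1 > 0" using c c1 by simp
  then have p: "p > 0" by (simp add: p_def c_def)
  have p2: "p\<^sup>2 = (1 / c - 1) / 3" using pos by (simp add: p_def c_def)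
  have 1: "1 + p\<^sup>2 = (1 + 2 * c) / (3 * c)" using c by (simp add: p2 field_simps)
  have 2: "2 + 3 * p\<^sup>2 = (1 + c) / c" using c by (simp add: p2 field_simps)
  have "sqrt 3 * p = sqrt (1 / c - 1)" by (simp add: p_def c_def flip: real_sqrt_mult)
  then have "sqrt 3 * p / sqrt (2 + 3 * p\<^sup>2) = sqrt ((1 / c - 1) / ((1 + c) / c))"
    by (simp only: 2 real_sqrt_divide)
  also have "(1 / c - 1) / ((1 + c) / c) = (1 - c) / (1 + c)"
  proof -
    have "1 / c - 1 = (1 - c) / c" using c by (simp add: diff_divide_distrib)
    then show ?thesis using c by simp
  qed
  finally have arc: "arctan (sqrt 3 * p / sqrt (2 + 3 * p\<^sup>2)) = t / 2"
    using arctan_sqrt_half_angle[of t] t by (simp add: c_def)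
  have "orthoscheme_density p = p * (t / 2) / (8 * ((1 + 2 * c) / (3 * c)) * sqrt ((1 + c) / c))"
    unfolding orthoscheme_density_def arc unfolding 1 2 ..
  also have "sqrt ((1 + c) / c) = sqrt (c * (1 + c)) / c"
  proof -
    have "(1 + c) / c = c * (1 + c) / c\<^sup>2" using c by (simp add: power2_eq_square)
    then show ?thesis using c by (simp add: real_sqrt_divide)
  qed
  finally have d: "orthoscheme_density p =
      p * (t / 2) / (8 * ((1 + 2 * c) / (3 * c)) * (sqrt (c * (1 + c)) / c))" .
  define r where "r = sqrt (c * (1 + c))"
  have r: "r > 0" using c by (simp add: r_def)
  define b where "b = 1 + 2 * c"
  have b: "b > 0" using c by (simp add: b_def)
  show ?thesis
    unfolding d c_def[symmetric] r_def[symmetric] b_def[symmetric]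
    using c p r b by (simp add: field_simps power2_eq_square)
qed

text \<open>
  Substitution of the edge length for the inradius. The latter is a square root that vanishes at
  \<open>t = 0\<close>, where it is only used to be continuous.
\<close>
lemma integral_orthoscheme_density:
  assumes a: "0 < a" "a < pi / 2"
  shows "((\<lambda>t. 6 * t * sin t / ((1 + 2 * cos t) * sqrt (cos t * (1 + cos t)))) has_integral
      192 * integral {0..sqrt ((1 / cos a - 1) / 3)} orthoscheme_density) {0..a}"
proof -
  define g where "g = (\<lambda>t :: real. sqrt ((1 / cos t - 1) / 3))"
  have cpos: "cos t > 0" if "t \<in> {0..a}" for t
    using that a by (intro cos_gt_zero_pi) auto
  have g0: "g 0 = 0" by (simp add: g_def)
  have img: "g t \<in> {0..g a}" if t: "t \<in> {0..a}" for t
  proof -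
    have "cos a \<le> cos t" using t a by (intro cos_monotone_0_pi_le) auto
    moreover have "cos a > 0" using cpos[of a] a by simp
    ultimately have "1 / cos t \<le> 1 / cos a" by (simp add: frac_le)
    moreover have "1 \<le> 1 / cos t" using cpos[OF t] by simp
    ultimately show ?thesis by (simp add: g_def)
  qed
  have H: "((\<lambda>t. (sin t / (6 * (cos t)\<^sup>2 * g t)) *\<^sub>R orthoscheme_density (g t)) has_integral
     integral {g 0..g a} orthoscheme_density - integral {g a..g 0} orthoscheme_density) {0..a}"
  proof (rule has_integral_substitution_general[where s = "{0}" and c = 0 and d = "g a" and g = g and
      f = orthoscheme_density and g' = "\<lambda>t. sin t / (6 * (cos t)\<^sup>2 * g t)"])
    show "continuous_on {0..a} g"
    proof -
      have "\<forall>t\<in>{0..a}. cos t \<noteq> 0" using cpos by fastforce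
      then show ?thesis unfolding g_def by (intro continuous_intros) auto
    qed
    fix t assume t: "t \<in> {0..a} - {0}"
    have c: "cos t > 0" using cpos t by simp
    have "cos t < cos 0" using t a by (intro cos_monotone_0_pi) auto
    with c have "(1 / cos t - 1) / 3 > 0" by simp
    then have gp: "g t > 0" by (simp add: g_def)
    have "((\<lambda>t. (1 / cos t - 1) / 3) has_real_derivative sin t / (3 * (cos t)\<^sup>2)) (at t)"
    proof -
      have "((\<lambda>t. (1 / cos t - 1) / 3) has_real_derivative
          ((0 * cos t - 1 * - sin t) / (cos t * cos t) - 0) / 3) (at t)"
        using c by (intro DERIV_cdivide DERIV_diff DERIV_divide DERIV_const DERIV_cos) simp
      then show ?thesis by (simp add: power2_eq_square mult.commute)
    qed
    from DERIV_chain2[where f = sqrt and g = "\<lambda>t. (1 / cos t - 1) / 3", OF DERIV_real_sqrt[OF \<open>(1 / cos t - 1) / 3 > 0\<close>] this]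
    have "(g has_real_derivative inverse (g t) / 2 * (sin t / (3 * (cos t)\<^sup>2))) (at t)"
      unfolding g_def .
    moreover have "inverse (g t) / 2 * (sin t / (3 * (cos t)\<^sup>2)) = sin t / (6 * (cos t)\<^sup>2 * g t)"
      using gp c by (simp add: field_simps)
    ultimately show "(g has_real_derivative sin t / (6 * (cos t)\<^sup>2 * g t)) (at t within {0..a})"
      by (metis has_field_derivative_at_within)
  qed (use a img in \<open>auto intro: continuous_on_orthoscheme_density\<close>)
  have Z: "integral {g a..g 0} orthoscheme_density = 0"
    using img[of a] a g0 by (cases "g a = 0") auto
  have "((\<lambda>t. 192 * (sin t / (6 * (cos t)\<^sup>2 * g t) * orthoscheme_density (g t))) has_integral
     192 * integral {0..g a} orthoscheme_density) {0..a}"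
    using has_integral_mult_right[OF H[unfolded Z, unfolded g0 diff_zero real_scaleR_def], of 192] .
  then show ?thesis
    unfolding g_def
  proof (rule has_integral_eq[rotated])
    fix t assume t: "t \<in> {0..a}"
    show "192 * (sin t / (6 * (cos t)\<^sup>2 * sqrt ((1 / cos t - 1) / 3)) * orthoscheme_density (sqrt ((1 / cos t - 1) / 3))) =
      6 * t * sin t / ((1 + 2 * cos t) * sqrt (cos t * (1 + cos t)))"
    proof (cases "t = 0")
      case False
      then show ?thesis
        using orthoscheme_density_pullback[of t] t a by auto
    qed simp
  qed
qed

text \<open>
  Substitution of the dihedral angle for the edge length: the angle \<open>\<phi> = arccos (- 1 / (1 + 2 * cos t))\<close> grows
  with \<open>t\<close>, and inverting this relation gives back \<open>t\<close> as the integrand of the first formula. Thus both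
  formulas integrate the edge length against the differential of the dihedral angle.
\<close>
lemma integral_over_dihedral_angle:
  assumes a: "0 < a" "a < pi / 2"
  shows "((\<lambda>t. 6 * t * sin t / ((1 + 2 * cos t) * sqrt (cos t * (1 + cos t)))) has_integral
     6 * integral {arccos (- 1 / 3)..arccos (- 1 / (1 + 2 * cos a))}
             (\<lambda>\<phi>. arccos (- ((cos \<phi> + 1) / (2 * cos \<phi>))))) {0..a}"
proof -
  define g where "g t = arccos (- 1 / (1 + 2 * cos t))" for t :: real
  define f where "f \<phi> = arccos (- ((cos \<phi> + 1) / (2 * cos \<phi>)))" for \<phi> :: real
  have cpos: "cos t > 0" if "t \<in> {0..a}" for t
    using that a by (intro cos_gt_zero_pi) auto
  have bounds: "-1 < - 1 / (1 + 2 * cos t)" "- 1 / (1 + 2 * cos t) < 0" "- 1 / (1 + 2 * cos t) \<le> - 1 / 3" if "t \<in> {0..a}" for t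
    using cpos[OF that] by (simp_all add: field_simps)
  have g0: "g 0 = arccos (- 1 / 3)" by (simp add: g_def)
  have img: "g t \<in> {g 0..g a}" if t: "t \<in> {0..a}" for t
  proof -
    have "cos a \<le> cos t" using t a by (intro cos_monotone_0_pi_le) auto
    moreover have "cos a > 0" using cpos[of a] a by simp
    ultimately have "- 1 / (1 + 2 * cos a) \<le> - 1 / (1 + 2 * cos t)" by (simp add: frac_le)
    moreover have "-1 < - 1 / (1 + 2 * cos a)" using bounds[of a] a by simp
    ultimately show ?thesis
      using bounds[OF t] unfolding g0 unfolding g_def atLeastAtMost_iff
      by (intro conjI arccos_le_arccos) linarith+
  qed
  have "((\<lambda>t. (sin t / ((1 + 2 * cos t) * sqrt (cos t * (1 + cos t)))) *\<^sub>R f (g t)) has_integral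
     integral {g 0..g a} f) {0..a}"
  proof (rule has_integral_substitution[where c = "g 0" and d = "g a" and g = g and f = f and
      g' = "\<lambda>t. sin t / ((1 + 2 * cos t) * sqrt (cos t * (1 + cos t)))"])
    show "continuous_on {g 0..g a} f"
    proof -
      have *: "cos \<phi> \<noteq> 0" "-1 \<le> - ((cos \<phi> + 1) / (2 * cos \<phi>))" "- ((cos \<phi> + 1) / (2 * cos \<phi>)) \<le> 1"
        if \<phi>: "\<phi> \<in> {g 0..g a}" for \<phi>
      proof -
        have "0 \<le> g 0" "g a \<le> pi"
          using bounds(1)[of a] bounds(2)[of a] a unfolding g0 unfolding g_def
          by (auto intro!: arccos_lbound arccos_ubound simp del: divide_minus_left)
        then have "cos \<phi> \<le> cos (g 0)" "cos \<phi> \<ge> -1" using \<phi> by (auto intro!: cos_monotone_0_pi_le)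
        moreover have "cos (g 0) = - 1 / 3" unfolding g0 by (intro cos_arccos) auto
        ultimately have c: "cos \<phi> \<le> - 1 / 3" "cos \<phi> \<ge> -1" by simp_all
        then show "cos \<phi> \<noteq> 0" "-1 \<le> - ((cos \<phi> + 1) / (2 * cos \<phi>))" "- ((cos \<phi> + 1) / (2 * cos \<phi>)) \<le> 1"
          by (auto simp: divide_simps)
      qed
      then show ?thesis
        unfolding f_def by (intro continuous_intros ballI) auto
    qed
    fix t assume t: "t \<in> {0..a}"
    define c where "c = cos t"
    have c: "c > 0" using cpos[OF t] by (simp add: c_def)
    define r where "r = sqrt (c * (1 + c))"
    have r: "r > 0" "r\<^sup>2 = c * (1 + c)" using c by (simp_all add: r_def)
    \<comment> \<open>The sine of the dihedral angle, needed for the derivative of its arc cosine.\<close>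
    have "1 - (- 1 / (1 + 2 * c))\<^sup>2 = (2 * r / (1 + 2 * c))\<^sup>2"
      using c by (simp add: power_divide power_mult_distrib r(2) divide_simps) (simp add: power2_eq_square algebra_simps)
    then have sq: "sqrt (1 - (- 1 / (1 + 2 * c))\<^sup>2) = 2 * r / (1 + 2 * c)"
      using c r by simp
    have "((\<lambda>t. - 1 / (1 + 2 * cos t)) has_real_derivative - (2 * sin t) / (1 + 2 * c)\<^sup>2) (at t)"
    proof -
      have "((\<lambda>t. - 1 / (1 + 2 * cos t)) has_real_derivative
          (0 * (1 + 2 * cos t) - - 1 * (0 + 2 * - sin t)) / ((1 + 2 * cos t) * (1 + 2 * cos t))) (at t)"
        using c unfolding c_def
        by (intro DERIV_divide DERIV_add DERIV_cmult DERIV_const DERIV_cos) simp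
      then show ?thesis by (simp add: power2_eq_square c_def)
    qed
    from DERIV_chain2[where f = arccos and g = "\<lambda>t. - 1 / (1 + 2 * cos t)", OF DERIV_arccos[OF bounds(1)[OF t]] this] bounds(2)[OF t]
    have "(g has_real_derivative inverse (- sqrt (1 - (- 1 / (1 + 2 * c))\<^sup>2)) * (- (2 * sin t) / (1 + 2 * c)\<^sup>2)) (at t)"
      by (simp add: g_def[abs_def] c_def)
    moreover have "inverse (- sqrt (1 - (- 1 / (1 + 2 * c))\<^sup>2)) * (- (2 * sin t) / (1 + 2 * c)\<^sup>2) = sin t / ((1 + 2 * c) * r)"
    proof -
      define b where "b = 1 + 2 * c"
      have "b > 0" using c by (simp add: b_def)
      then show ?thesis
        unfolding sq unfolding b_def[symmetric] using r by (simp add: power2_eq_square field_simps)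
    qed
    ultimately show "(g has_real_derivative sin t / ((1 + 2 * cos t) * sqrt (cos t * (1 + cos t)))) (at t within {0..a})"
      by (metis has_field_derivative_at_within c_def r_def)
  qed (use a img[of a] img in auto)
  from has_integral_mult_right[OF this, of 6]
  have "((\<lambda>t. 6 * (sin t / ((1 + 2 * cos t) * sqrt (cos t * (1 + cos t))) * f (g t))) has_integral
     6 * integral {g 0..g a} f) {0..a}" by simp
  then have "((\<lambda>t. 6 * t * sin t / ((1 + 2 * cos t) * sqrt (cos t * (1 + cos t)))) has_integral
     6 * integral {g 0..g a} f) {0..a}"
  proof (rule has_integral_eq[rotated])
    fix t assume t: "t \<in> {0..a}"
    define c where "c = cos t"
    have c: "c > 0" using cpos[OF t] by (simp add: c_def)
    \<comment> \<open>The integrand inverts the relation between edge length and dihedral angle.\<close>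
    have cg: "cos (g t) = - 1 / (1 + 2 * c)"
      unfolding g_def c_def using bounds[OF t] by (intro cos_arccos) linarith+
    have "- ((cos (g t) + 1) / (2 * cos (g t))) = c"
      unfolding cg using c by (simp add: field_simps)
    then have "f (g t) = t"
      using t a by (simp add: f_def c_def arccos_cos)
    then show "6 * (sin t / ((1 + 2 * cos t) * sqrt (cos t * (1 + cos t))) * f (g t)) =
      6 * t * sin t / ((1 + 2 * cos t) * sqrt (cos t * (1 + cos t)))" by simp
  qed
  then show ?thesis
    unfolding g0 unfolding g_def f_def .
qed

section \<open>Position of the vertices, conormals and volume\<close>

lemma orthonormal_frame_expand:
  assumes "orthonormal_frame a b c d"
  shows "x = (x \<bullet> a) *\<^sub>R a + (x \<bullet> b) *\<^sub>R b + (x \<bullet> c) *\<^sub>R c + (x \<bullet> d) *\<^sub>R d"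
proof -
  let ?h = "\<lambda>x. vec4 (x \<bullet> a) (x \<bullet> b) (x \<bullet> c) (x \<bullet> d)"
  have "?h x = ?h ((x \<bullet> a) *\<^sub>R a + (x \<bullet> b) *\<^sub>R b + (x \<bullet> c) *\<^sub>R c + (x \<bullet> d) *\<^sub>R d)"
    using assms by (simp add: orthonormal_frame_def inner_simps inner_commute)
  then show ?thesis
    using orthogonal_transformation_inj[OF orthogonal_frame_coordinates[OF assms]]
    by (rule injD[rotated])
qed

lemma norm_orthonormal_combination:
  assumes "orthonormal_frame a b c d"
  shows "(norm (\<alpha> *\<^sub>R a + \<beta> *\<^sub>R b + \<gamma> *\<^sub>R c + \<delta> *\<^sub>R d))\<^sup>2 = \<alpha>\<^sup>2 + \<beta>\<^sup>2 + \<gamma>\<^sup>2 + \<delta>\<^sup>2"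
  using assms unfolding power2_norm_eq_inner
  by (simp add: orthonormal_frame_def inner_simps inner_commute power2_eq_square)

definition sign_of :: "bool \<Rightarrow> real" where
  "sign_of s = (if s then 1 else - 1)"

lemma sign_of_simps [simp]: "sign_of True = 1" "sign_of False = - 1"
  by (simp_all add: sign_of_def)

text \<open>
  Equal inner products between vertices of different pairs make the three diagonals mutually orthogonal and
  orthogonal to the midpoints of all pairs. In dimension four the midpoints therefore lie on one line. Their
  pairwise inner products agree, so they coincide, and then the diagonals have the same length; the centre has
  the direction \<open>n\<close>. Excluding antipodal pairs matters: with \<open>c = 0\<close> two of the midpoints would vanish and the
  third would be undetermined.
\<close>
lemma opposite_pairs_frame:
  fixes v :: "3 \<times> bool \<Rightarrow> point"
  assumes unit: "\<And>x. norm (v x) = 1"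
    and inner: "\<And>i j s t. i \<noteq> j \<Longrightarrow> v (i, s) \<bullet> v (j, t) = c"
    and ne: "\<And>i. v (i, True) \<noteq> v (i, False)" "\<And>i. v (i, True) \<noteq> - v (i, False)"
  obtains e n \<mu> R where "orthonormal_frame (e 1) (e 2) (e 3) n" "\<mu> > 0" "R > 0"
    "\<mu>\<^sup>2 = c" "\<mu>\<^sup>2 * (1 + R\<^sup>2) = 1" "\<And>i s. v (i, s) = \<mu> *\<^sub>R (n + (sign_of s * R) *\<^sub>R e i)"
proof -
  define w m where "w i = v (i, True) - v (i, False)" and "m i = v (i, True) + v (i, False)" for i
  have vv: "v x \<bullet> v x = 1" for x using unit[of x] by (simp add: norm_eq_1)
  have ww: "w i \<bullet> w j = 0" if "i \<noteq> j" for i j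
    using that by (simp add: w_def inner_simps inner)
  have wm: "w i \<bullet> m j = 0" for i j
    by (cases "i = j") (simp_all add: w_def m_def inner_simps inner vv inner_commute)
  have mm: "m i \<bullet> m j = 4 * c" if "i \<noteq> j" for i j
    using that by (simp add: m_def inner_simps inner)
  have w0: "w i \<noteq> 0" and m0: "m i \<noteq> 0" for i
    using ne[of i] by (auto simp: w_def m_def add_eq_0_iff)
  define e n where "e i = w i /\<^sub>R norm (w i)" and "n = m 1 /\<^sub>R norm (m 1)" for i
  have we: "w i = norm (w i) *\<^sub>R e i" for i using w0 by (simp add: e_def)
  have ee: "e i \<bullet> e i = 1" for i
    using w0[of i] by (intro norm_eq_1[THEN iffD1]) (simp add: e_def)
  have ee0: "e i \<bullet> e j = 0" if "i \<noteq> j" for i j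
    using ww[OF that] by (simp add: e_def)
  have nn: "n \<bullet> n = 1" using m0[of 1] by (intro norm_eq_1[THEN iffD1]) (simp add: n_def)
  have en: "e i \<bullet> n = 0" for i using wm by (simp add: e_def n_def)
  have frame: "orthonormal_frame (e 1) (e 2) (e 3) n"
    unfolding orthonormal_frame_def using ee ee0 nn en by simp
  define \<nu> where "\<nu> i = m i \<bullet> n" for i
  have mn: "m i = \<nu> i *\<^sub>R n" for i
  proof -
    have "m i \<bullet> e j = 0" for j using wm by (simp add: e_def inner_commute)
    then show ?thesis
      using orthonormal_frame_expand[OF frame, of "m i"] by (simp add: \<nu>_def)
  qed
  have \<nu>\<nu>: "\<nu> i * \<nu> j = 4 * c" if "i \<noteq> j" for i j
    using mm[OF that] unfolding mn[of i] mn[of j] by (simp add: nn mult.commute)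
  have \<nu>0: "\<nu> i \<noteq> 0" for i using m0[of i] mn[of i] by auto
  have "\<nu> 1 > 0"
  proof -
    have "\<nu> 1 = norm (m 1)" using m0[of 1] by (simp add: \<nu>_def n_def dot_square_norm power2_eq_square)
    then show ?thesis using m0 by simp
  qed
  have "\<nu> 1 * \<nu> 2 = \<nu> 1 * \<nu> 3" "\<nu> 1 * \<nu> 2 = \<nu> 3 * \<nu> 2"
    using \<nu>\<nu>[of 1 2] \<nu>\<nu>[of 1 3] \<nu>\<nu>[of 3 2] by simp_all
  then have "\<nu> 2 = \<nu> 3" "\<nu> 1 = \<nu> 3"
    using \<nu>0[of 1] \<nu>0[of 2] by simp_all
  then have \<nu>1: "\<nu> i = \<nu> 1" for i
    using exhaust_3[of i] by auto
  define \<mu> where "\<mu> = \<nu> 1 / 2"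
  have \<mu>: "\<mu> > 0" "\<mu>\<^sup>2 = c"
    using \<open>\<nu> 1 > 0\<close> \<nu>\<nu>[of 1 2] \<nu>1[of 2] by (simp_all add: \<mu>_def power2_eq_square)
  have m\<mu>: "m i = (2 * \<mu>) *\<^sub>R n" for i using mn[of i] \<nu>1[of i] by (simp add: \<mu>_def)
  have nw: "(norm (w i))\<^sup>2 = 4 - 4 * \<mu>\<^sup>2" for i
  proof -
    have "(norm (w i))\<^sup>2 + (norm (m i))\<^sup>2 = 4"
      unfolding power2_norm_eq_inner by (simp add: w_def m_def inner_simps vv inner_commute)
    moreover have "norm (m i) = 2 * \<mu>"
      using nn[folded norm_eq_1] \<mu> by (simp add: m\<mu>)
    ultimately show ?thesis by (simp add: power_mult_distrib)
  qed
  define R where "R = norm (w 1) / (2 * \<mu>)"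
  have R: "R > 0" using w0 \<mu> by (simp add: R_def)
  have wR: "norm (w i) = 2 * \<mu> * R" for i
  proof -
    have "norm (w i) = norm (w 1)"
      using nw[of i] nw[of 1] by (metis norm_ge_zero power2_eq_iff_nonneg)
    then show ?thesis using \<mu> by (simp add: R_def)
  qed
  have sq: "\<mu>\<^sup>2 * (1 + R\<^sup>2) = 1"
    using nw[of 1] by (simp add: wR power_mult_distrib algebra_simps)
  have "v (i, s) = \<mu> *\<^sub>R (n + (sign_of s * R) *\<^sub>R e i)" for i s
  proof -
    have "2 *\<^sub>R v (i, s) = m i + sign_of s *\<^sub>R w i"
      by (cases s) (simp_all add: m_def w_def scaleR_2)
    also have "\<dots> = 2 *\<^sub>R (\<mu> *\<^sub>R (n + (sign_of s * R) *\<^sub>R e i))"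
      by (subst we) (simp add: m\<mu> wR scaleR_add_right mult_ac)
    finally show ?thesis by (rule scaleR_left_imp_eq[rotated]) simp
  qed
  with frame \<mu> R sq show ?thesis by (intro that)
qed

text \<open>
  The facet spans the hyperplane orthogonal to its normal, and in it the conditions of being
  orthogonal to the ends of the edge leave a line; the third vertex of the facet selects its direction.
\<close>
lemma inward_conormal_eq:
  assumes fr: "orthonormal_frame a b c n" and R: "R > 0" and pos: "\<mu> > 0"
    and E: "\<mu> *\<^sub>R (n + R *\<^sub>R a) \<in> E" "\<mu> *\<^sub>R (n + R *\<^sub>R b) \<in> E"
      "E \<subseteq> span {\<mu> *\<^sub>R (n + R *\<^sub>R a), \<mu> *\<^sub>R (n + R *\<^sub>R b)}"
    and EF: "E \<subseteq> F" and F: "\<mu> *\<^sub>R (n + R *\<^sub>R c) \<in> F"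
    and plane: "\<And>x. x \<in> F \<Longrightarrow> x \<bullet> a + x \<bullet> b + x \<bullet> c = R * (x \<bullet> n)"
    and nonneg: "\<And>x. x \<in> F \<Longrightarrow> 0 \<le> x \<bullet> c"
  shows "inward_conormal E F = (1 / sqrt (1 + 2 / R\<^sup>2 + (R + 2 / R)\<^sup>2)) *\<^sub>R
     (- (1 / R) *\<^sub>R a + - (1 / R) *\<^sub>R b + (R + 2 / R) *\<^sub>R c + 1 *\<^sub>R n)"
proof -
  define L where "L = 1 + 2 / R\<^sup>2 + (R + 2 / R)\<^sup>2"
  have L: "L > 0" using R by (simp add: L_def add_pos_nonneg)
  define w where "w = - (1 / R) *\<^sub>R a + - (1 / R) *\<^sub>R b + (R + 2 / R) *\<^sub>R c + 1 *\<^sub>R n"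
  have inner_a: "w \<bullet> a = - (1 / R)" and inner_b: "w \<bullet> b = - (1 / R)" and inner_c: "w \<bullet> c = R + 2 / R" and inner_n: "w \<bullet> n = 1"
    using fr by (simp_all add: w_def orthonormal_frame_def inner_simps inner_commute)
  have norm_w: "(norm w)\<^sup>2 = L"
    unfolding w_def norm_orthonormal_combination[OF fr] L_def by (simp add: power_divide)
  have nw: "norm w = sqrt L"
    using norm_w by (metis norm_ge_zero real_sqrt_unique)
  have "inward_conormal E F = (1 / sqrt L) *\<^sub>R w"
    unfolding inward_conormal_def
  proof (rule the_equality, intro conjI ballI)
    show "norm ((1 / sqrt L) *\<^sub>R w) = 1"
      using nw L by simp
    \<comment> \<open>Up to a factor, the third vertex minus its projection onto the plane of the edge.\<close>
    have span_w: "w = ((2 + R\<^sup>2) / (R\<^sup>2 * \<mu>)) *\<^sub>R (\<mu> *\<^sub>R (n + R *\<^sub>R c)) -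
        (1 / (R\<^sup>2 * \<mu>)) *\<^sub>R (\<mu> *\<^sub>R (n + R *\<^sub>R a)) - (1 / (R\<^sup>2 * \<mu>)) *\<^sub>R (\<mu> *\<^sub>R (n + R *\<^sub>R b))" (is "w = ?r")
    proof -
      have "?r \<bullet> a = - (1 / R)" "?r \<bullet> b = - (1 / R)" "?r \<bullet> c = R + 2 / R" "?r \<bullet> n = 1"
        using fr R pos unfolding orthonormal_frame_def
        by (simp_all add: inner_simps inner_commute) (simp_all add: power2_eq_square divide_simps)
      then show ?thesis
        using orthonormal_frame_expand[OF fr, of ?r] by (simp only: w_def)
    qed
    have "w \<in> span F"
      unfolding span_w using E(1,2) EF F by (intro span_diff span_scale span_base) auto
    then show "(1 / sqrt L) *\<^sub>R w \<in> span F" by (rule span_scale)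
    have "w \<bullet> (\<mu> *\<^sub>R (n + R *\<^sub>R a)) = 0" "w \<bullet> (\<mu> *\<^sub>R (n + R *\<^sub>R b)) = 0"
      using R by (simp_all add: inner_simps inner_a inner_b inner_n)
    then have "span {\<mu> *\<^sub>R (n + R *\<^sub>R a), \<mu> *\<^sub>R (n + R *\<^sub>R b)} \<subseteq> {x. w \<bullet> x = 0}"
      by (intro span_minimal subspace_hyperplane) auto
    then show "(1 / sqrt L) *\<^sub>R w \<bullet> x = 0" if "x \<in> E" for x
      using E(3) that by auto
    show "(1 / sqrt L) *\<^sub>R w \<bullet> x \<ge> 0" if x: "x \<in> F" for x
    proof -
      have "w \<bullet> x = - (1 / R) * (x \<bullet> a + x \<bullet> b) + (R + 2 / R) * (x \<bullet> c) + x \<bullet> n"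
        by (simp add: w_def inner_simps inner_commute algebra_simps)
      also have "x \<bullet> a + x \<bullet> b = R * (x \<bullet> n) - x \<bullet> c" using plane[OF x] by simp
      also have "- (1 / R) * (R * (x \<bullet> n) - x \<bullet> c) + (R + 2 / R) * (x \<bullet> c) + x \<bullet> n = (R + 3 / R) * (x \<bullet> c)"
        using R by (simp add: field_simps)
      also have "\<dots> \<ge> 0" using R nonneg[OF x] by simp
      finally show ?thesis using L by simp
    qed
  next
    fix u
    assume u: "norm u = 1 \<and> u \<in> span F \<and> (\<forall>x\<in>E. u \<bullet> x = 0) \<and> (\<forall>x\<in>F. u \<bullet> x \<ge> 0)"
    have "u \<in> {x. x \<bullet> a + x \<bullet> b + x \<bullet> c = R * (x \<bullet> n)}"
    proof (rule subsetD[OF span_minimal])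
      show "F \<subseteq> {x. x \<bullet> a + x \<bullet> b + x \<bullet> c = R * (x \<bullet> n)}" using plane by auto
      show "subspace {x. x \<bullet> a + x \<bullet> b + x \<bullet> c = R * (x \<bullet> n)}"
        by (auto simp: subspace_def inner_simps algebra_simps) (metis distrib_left)
    qed (use u in simp)
    then have sum: "u \<bullet> a + u \<bullet> b + u \<bullet> c = R * (u \<bullet> n)" by simp
    have "u \<bullet> (\<mu> *\<^sub>R (n + R *\<^sub>R a)) = 0" "u \<bullet> (\<mu> *\<^sub>R (n + R *\<^sub>R b)) = 0" "u \<bullet> (\<mu> *\<^sub>R (n + R *\<^sub>R c)) \<ge> 0"
      using u E F by auto
    then have eqs: "u \<bullet> n + R * (u \<bullet> a) = 0" "u \<bullet> n + R * (u \<bullet> b) = 0" and ge: "u \<bullet> n + R * (u \<bullet> c) \<ge> 0"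
      using pos by (simp_all add: inner_simps zero_le_mult_iff)
    define k where "k = u \<bullet> n"
    have ua: "u \<bullet> a = k * - (1 / R)" and ub: "u \<bullet> b = k * - (1 / R)"
      using eqs R by (simp_all add: k_def field_simps)
    have uc: "u \<bullet> c = k * (R + 2 / R)"
      using sum R unfolding ua ub k_def[symmetric] by (simp add: field_simps)
    have "u = k *\<^sub>R w"
      using orthonormal_frame_expand[OF fr, of u]
      unfolding ua ub uc k_def[symmetric] w_def
      by (simp only: scaleR_add_right scaleR_scaleR mult_1_right)
    moreover have "k \<ge> 0"
    proof -
      have "u \<bullet> n + R * (u \<bullet> c) = k * (3 + R\<^sup>2)"
        unfolding uc k_def[symmetric] using R by (simp add: field_simps power2_eq_square)
      then have "k * (3 + R\<^sup>2) \<ge> 0" using ge by simp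
      moreover have "3 + R\<^sup>2 > 0" by (simp add: add_pos_nonneg)
      ultimately show ?thesis by (simp add: zero_le_mult_iff)
    qed
    ultimately have "k * sqrt L = 1" using u nw by simp
    then have "k = 1 / sqrt L" using L by (simp add: field_simps)
    with \<open>u = k *\<^sub>R w\<close> show "u = (1 / sqrt L) *\<^sub>R w" by simp
  qed
  then show ?thesis unfolding L_def w_def .
qed

text \<open>
  Four times the measure of the cone, which consists of 48 orthoscheme cones.
\<close>
lemma svol_octahedron:
  assumes fr: "orthonormal_frame a b c n" and R: "R > 0"
    and P: "P = {x \<in> S3. \<bar>x \<bullet> a\<bar> + \<bar>x \<bullet> b\<bar> + \<bar>x \<bullet> c\<bar> \<le> R * (x \<bullet> n)}"
  shows "svol P = 192 * integral {0..R / sqrt 3} orthoscheme_density"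
proof -
  have n: "n \<in> P"
    using fr R by (simp add: P orthonormal_frame_def norm_eq_1 inner_commute)
  have "{t *\<^sub>R x | t x. t \<in> {0..1} \<and> x \<in> P} = octahedral_cone a b c n R"
  proof (intro equalityI subsetI)
    fix y assume "y \<in> {t *\<^sub>R x | t x. t \<in> {0..1} \<and> x \<in> P}"
    then obtain t x where y: "y = t *\<^sub>R x" and t: "0 \<le> t" "t \<le> 1" and x: "x \<in> P" by auto
    have "t * (\<bar>x \<bullet> a\<bar> + \<bar>x \<bullet> b\<bar> + \<bar>x \<bullet> c\<bar>) \<le> t * (R * (x \<bullet> n))"
      using x t by (intro mult_left_mono) (simp_all add: P)
    then show "y \<in> octahedral_cone a b c n R"
      using x t by (simp add: y octahedral_cone_def P abs_mult algebra_simps)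
  next
    fix y assume y: "y \<in> octahedral_cone a b c n R"
    show "y \<in> {t *\<^sub>R x | t x. t \<in> {0..1} \<and> x \<in> P}"
    proof (cases "y = 0")
      case True
      then have "y = 0 *\<^sub>R n" by simp
      with n show ?thesis by force
    next
      case False
      let ?x = "y /\<^sub>R norm y"
      have "inverse (norm y) * (\<bar>y \<bullet> a\<bar> + \<bar>y \<bullet> b\<bar> + \<bar>y \<bullet> c\<bar>) \<le> inverse (norm y) * (R * (y \<bullet> n))"
        using y by (intro mult_left_mono) (simp_all add: octahedral_cone_def)
      then have "?x \<in> P" using False by (simp add: P abs_mult algebra_simps)
      moreover have "y = norm y *\<^sub>R ?x" "norm y \<in> {0..1}"
        using False y by (simp_all add: octahedral_cone_def)
      ultimately show ?thesis by blast
    qed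
  qed
  then show ?thesis
    by (simp add: svol_def measure_octahedral_cone[OF fr R])
qed

section \<open>Facets and dihedral angle of the octahedron\<close>

lemma orthonormal_frame_signs:
  assumes "orthonormal_frame a b c n"
  shows "orthonormal_frame (sign_of r *\<^sub>R a) (sign_of s *\<^sub>R b) (sign_of t *\<^sub>R c) n"
  using assms by (cases r; cases s; cases t) (simp_all add: orthonormal_frame_def)

text \<open>
  The normal of a facet is orthogonal to its three vertices, which determines it up to a factor; the
  sign of the factor is fixed by one vertex on the other side.
\<close>
lemma facet_halfspace:
  assumes fr: "orthonormal_frame a b c n" and \<mu>: "\<mu> > 0" and R: "R > 0"
    and F: "F \<in> facets P" "\<mu> *\<^sub>R (n + R *\<^sub>R a) \<in> F" "\<mu> *\<^sub>R (n + R *\<^sub>R b) \<in> F" "\<mu> *\<^sub>R (n + R *\<^sub>R c) \<in> F"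
    and P: "\<mu> *\<^sub>R (n - R *\<^sub>R a) \<in> P"
  shows "P \<subseteq> {x. x \<bullet> a + x \<bullet> b + x \<bullet> c \<le> R * (x \<bullet> n)}"
    and "F = {x \<in> P. x \<bullet> a + x \<bullet> b + x \<bullet> c = R * (x \<bullet> n)}"
proof -
  obtain u where u: "u \<in> S3" "P \<subseteq> shemisphere u" "F = P \<inter> great_sphere u"
    using F(1) by (auto simp: facets_def spherical_face_def)
  define k where "k = u \<bullet> n"
  have "u \<bullet> (\<mu> *\<^sub>R (n + R *\<^sub>R a)) = 0" "u \<bullet> (\<mu> *\<^sub>R (n + R *\<^sub>R b)) = 0" "u \<bullet> (\<mu> *\<^sub>R (n + R *\<^sub>R c)) = 0"
    using F(2-4) unfolding u(3) great_sphere_def by simp_all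
  then have eqs: "k + R * (u \<bullet> a) = 0" "k + R * (u \<bullet> b) = 0" "k + R * (u \<bullet> c) = 0"
    using \<mu> by (simp_all add: inner_simps k_def)
  then have co: "u \<bullet> a = - (k / R)" "u \<bullet> b = - (k / R)" "u \<bullet> c = - (k / R)"
    using R by (simp_all add: field_simps)
  have expand: "u = (- (k / R)) *\<^sub>R a + (- (k / R)) *\<^sub>R b + (- (k / R)) *\<^sub>R c + k *\<^sub>R n"
    using orthonormal_frame_expand[OF fr, of u] unfolding co k_def[symmetric] .
  have "u \<noteq> 0" using u(1) by auto
  then have "k \<noteq> 0" using expand by auto
  moreover have "0 \<le> u \<bullet> (\<mu> *\<^sub>R (n - R *\<^sub>R a))"
    using P u(2) by (auto simp: shemisphere_def)
  then have "0 \<le> \<mu> * (k + k)"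
    using R by (simp add: inner_simps co k_def[symmetric])
  ultimately have k: "k > 0" using \<mu> by (simp add: zero_le_mult_iff)
  have ux: "u \<bullet> x = (k / R) * (R * (x \<bullet> n) - (x \<bullet> a + x \<bullet> b + x \<bullet> c))" for x
    using R by (subst expand) (simp add: inner_simps inner_commute algebra_simps)
  have kR: "k / R > 0" using k R by simp
  show "P \<subseteq> {x. x \<bullet> a + x \<bullet> b + x \<bullet> c \<le> R * (x \<bullet> n)}"
  proof
    fix x assume "x \<in> P"
    then have "0 \<le> u \<bullet> x" using u(2) by (auto simp: shemisphere_def)
    then have "0 \<le> R * (x \<bullet> n) - (x \<bullet> a + x \<bullet> b + x \<bullet> c)"
      unfolding ux zero_le_mult_iff using kR by linarith
    then show "x \<in> {x. x \<bullet> a + x \<bullet> b + x \<bullet> c \<le> R * (x \<bullet> n)}" by simp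
  qed
  have "P \<subseteq> S3" using u(2) by (auto simp: shemisphere_def)
  then show "F = {x \<in> P. x \<bullet> a + x \<bullet> b + x \<bullet> c = R * (x \<bullet> n)}"
    unfolding u(3) great_sphere_def ux using k R by auto
qed

text \<open>
  A half-space that contains the six vertices contains the cone that they generate. The hypothesis
  on the vertices says that every \<open>R * \<bar>u \<bullet> w\<bar>\<close> is at most \<open>u \<bullet> n\<close>, which is the dual form of the octahedral inequality.
\<close>
lemma octahedral_region_subset_hemisphere:
  assumes fr: "orthonormal_frame a b c n" and \<mu>: "\<mu> > 0" and R: "R > 0"
    and u: "\<And>w. w \<in> {a, - a, b, - b, c, - c} \<Longrightarrow> 0 \<le> u \<bullet> (\<mu> *\<^sub>R (n + R *\<^sub>R w))"
    and x: "\<bar>x \<bullet> a\<bar> + \<bar>x \<bullet> b\<bar> + \<bar>x \<bullet> c\<bar> \<le> R * (x \<bullet> n)"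
  shows "0 \<le> u \<bullet> x"
proof -
  define k where "k = u \<bullet> n"
  have u': "0 \<le> k + R * (u \<bullet> w)" if "w \<in> {a, - a, b, - b, c, - c}" for w
    using u[OF that] \<mu> by (simp add: inner_simps k_def zero_le_mult_iff)
  have abs_le: "R * \<bar>u \<bullet> w\<bar> \<le> k" if "w \<in> {a, b, c}" for w
    using u'[of w] u'[of "- w"] that R by (auto simp: abs_if)
  have "0 \<le> R * \<bar>u \<bullet> a\<bar>" using R by simp
  then have "k \<ge> 0" using abs_le[of a] by simp
  have bound: "- (\<bar>x \<bullet> w\<bar> * k) \<le> R * ((x \<bullet> w) * (u \<bullet> w))" if "w \<in> {a, b, c}" for w
  proof -
    have "\<bar>R * ((x \<bullet> w) * (u \<bullet> w))\<bar> = \<bar>x \<bullet> w\<bar> * (R * \<bar>u \<bullet> w\<bar>)"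
      using R by (simp add: abs_mult)
    also have "\<dots> \<le> \<bar>x \<bullet> w\<bar> * k"
      using abs_le[OF that] by (intro mult_left_mono) auto
    finally show ?thesis by linarith
  qed
  have "u \<bullet> x = (x \<bullet> a) * (u \<bullet> a) + (x \<bullet> b) * (u \<bullet> b) + (x \<bullet> c) * (u \<bullet> c) + (x \<bullet> n) * k"
    by (subst orthonormal_frame_expand[OF fr, of x]) (simp add: inner_add_right k_def)
  then have "R * (u \<bullet> x) = R * ((x \<bullet> a) * (u \<bullet> a)) + R * ((x \<bullet> b) * (u \<bullet> b)) + R * ((x \<bullet> c) * (u \<bullet> c)) + R * (x \<bullet> n) * k"
    by (simp add: algebra_simps)
  moreover have "(\<bar>x \<bullet> a\<bar> + \<bar>x \<bullet> b\<bar> + \<bar>x \<bullet> c\<bar>) * k \<le> R * (x \<bullet> n) * k"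
    using x \<open>k \<ge> 0\<close> by (rule mult_right_mono)
  ultimately have "0 \<le> R * (u \<bullet> x)"
    using bound[of a] bound[of b] bound[of c] by (simp add: distrib_right)
  then show ?thesis using R by (simp add: zero_le_mult_iff)
qed

text \<open>
  With the third frame vector reversed, the frame describes the facet on the other side of the edge.
\<close>
lemma dihedral_angle_value:
  assumes fr: "orthonormal_frame a b c n" and R: "R > 0"
    and F: "inward_conormal E F = (1 / sqrt (1 + 2 / R\<^sup>2 + (R + 2 / R)\<^sup>2)) *\<^sub>R
     (- (1 / R) *\<^sub>R a + - (1 / R) *\<^sub>R b + (R + 2 / R) *\<^sub>R c + 1 *\<^sub>R n)"
    and G: "inward_conormal E G = (1 / sqrt (1 + 2 / R\<^sup>2 + (R + 2 / R)\<^sup>2)) *\<^sub>R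
     (- (1 / R) *\<^sub>R a + - (1 / R) *\<^sub>R b + (R + 2 / R) *\<^sub>R (- c) + 1 *\<^sub>R n)"
  shows "dihedral_angle E F G = arccos (- ((R\<^sup>2 + 1) / (R\<^sup>2 + 3)))"
proof -
  define L where "L = 1 + 2 / R\<^sup>2 + (R + 2 / R)\<^sup>2"
  have L: "L > 0" using R by (simp add: L_def add_pos_nonneg)
  define f g where "f = - (1 / R) *\<^sub>R a + - (1 / R) *\<^sub>R b + (R + 2 / R) *\<^sub>R c + 1 *\<^sub>R n"
    and "g = - (1 / R) *\<^sub>R a + - (1 / R) *\<^sub>R b + (R + 2 / R) *\<^sub>R (- c) + 1 *\<^sub>R n"
  have fr': "orthonormal_frame a b (- c) n" using fr by (rule orthonormal_frame_minus)
  have ff: "(norm f)\<^sup>2 = L" and gg: "(norm g)\<^sup>2 = L"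
    unfolding f_def g_def norm_orthonormal_combination[OF fr] norm_orthonormal_combination[OF fr'] L_def
    by (simp_all add: power_divide)
  have "f \<bullet> g = 1 + 2 / R\<^sup>2 - (R + 2 / R)\<^sup>2"
    using fr unfolding orthonormal_frame_def f_def g_def
    by (simp add: inner_simps inner_commute power2_eq_square)
  moreover have "norm f * norm g = L"
    using ff gg by (metis norm_ge_zero power2_eq_iff_nonneg power2_eq_square)
  ultimately have "f \<bullet> g / (norm f * norm g) = (1 + 2 / R\<^sup>2 - (R + 2 / R)\<^sup>2) / L" by simp
  also have "\<dots> = - ((R\<^sup>2 + 1) / (R\<^sup>2 + 3))"
  proof -
    have 1: "R\<^sup>2 * (1 + 2 / R\<^sup>2 - (R + 2 / R)\<^sup>2) = - ((R\<^sup>2 + 1) * (R\<^sup>2 + 2))"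
      using R by (simp add: field_simps power2_eq_square)
    have 2: "R\<^sup>2 * L = (R\<^sup>2 + 3) * (R\<^sup>2 + 2)"
      using R unfolding L_def by (simp add: field_simps power2_eq_square)
    have "R\<^sup>2 \<noteq> 0" "R\<^sup>2 + 2 \<noteq> 0" using R by (simp_all add: add_nonneg_eq_0_iff)
    have "(1 + 2 / R\<^sup>2 - (R + 2 / R)\<^sup>2) / L = R\<^sup>2 * (1 + 2 / R\<^sup>2 - (R + 2 / R)\<^sup>2) / (R\<^sup>2 * L)"
      by (rule mult_divide_mult_cancel_left[symmetric]) fact
    also have "\<dots> = - ((R\<^sup>2 + 1) / (R\<^sup>2 + 3))"
      unfolding 1 2 using \<open>R\<^sup>2 + 2 \<noteq> 0\<close> by simp
    finally show ?thesis .
  qed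
  finally have *: "f \<bullet> g / (norm f * norm g) = - ((R\<^sup>2 + 1) / (R\<^sup>2 + 3))" .
  have "dihedral_angle E F G = vec_angle ((1 / sqrt L) *\<^sub>R f) ((1 / sqrt L) *\<^sub>R g)"
    unfolding dihedral_angle_def F G f_def g_def L_def ..
  also have "\<dots> = arccos (f \<bullet> g / (norm f * norm g))"
    unfolding vec_angle_def using L by simp
  finally show ?thesis unfolding * .
qed

section \<open>The volume formulas\<close>

theorem theorem2:
  fixes P :: "(real ^ 4) set" and a A :: real
  assumes "regular_spherical_octahedron P"
    and "all_edge_lengths P a"
    and "all_dihedral_angles P A"
  shows "svol P = 6 * integral {arccos (- 1 / 3)..A}
             (\<lambda>\<phi>. arccos (- ((cos \<phi> + 1) / (2 * cos \<phi>)))) \<and>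
         svol P = integral {0..a}
             (\<lambda>t. 6 * t * sin t / ((1 + 2 * cos t) * sqrt (cos t * (1 + cos t))))"
proof -
  have poly: "convex_spherical_polyhedron P" and oct: "octahedral_type P"
    using assms(1) by (auto simp: regular_spherical_octahedron_def)
  obtain U where U: "U \<subseteq> S3" "P = S3 \<inter> (\<Inter>u\<in>U. shemisphere u)" and antipodal: "\<And>x. x \<in> P \<Longrightarrow> - x \<notin> P"
    using poly unfolding convex_spherical_polyhedron_def by blast
  obtain v :: "3 \<times> bool \<Rightarrow> point" where v: "inj v" "range v = vertices P"
    "(\<lambda>E. E \<inter> vertices P) ` edges P = {{v (i, s), v (j, t)} | i j s t. i \<noteq> j}"
    "(\<lambda>F. F \<inter> vertices P) ` facets P = {range (\<lambda>i. v (i, s i)) | s. True}"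
    using oct unfolding octahedral_type_def by (elim exE conjE) (rule that)
  have vP: "v x \<in> P" for x
  proof -
    have "v x \<in> vertices P" using v(2) by auto
    then show ?thesis by (auto simp: vertices_def spherical_face_def)
  qed
  have unit: "norm (v x) = 1" for x using vP[of x] U(2) by simp
  have edge: "\<exists>E\<in>edges P. E \<inter> vertices P = {v (i, s), v (j, t)}" if "i \<noteq> j" for i j s t
  proof -
    have "{v (i, s), v (j, t)} \<in> (\<lambda>E. E \<inter> vertices P) ` edges P"
      unfolding v(3) using that by blast
    then obtain E where "{v (i, s), v (j, t)} = E \<inter> vertices P" "E \<in> edges P" by (rule imageE)
    then show ?thesis by (intro bexI[of _ E]) (rule sym)
  qed
  have facet: "\<exists>F\<in>facets P. F \<inter> vertices P = range (\<lambda>i. v (i, s i))" for s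
  proof -
    have "range (\<lambda>i. v (i, s i)) \<in> (\<lambda>F. F \<inter> vertices P) ` facets P"
      unfolding v(4) by blast
    then obtain F where "range (\<lambda>i. v (i, s i)) = F \<inter> vertices P" "F \<in> facets P" by (rule imageE)
    then show ?thesis by (intro bexI[of _ F]) (rule sym)
  qed
  have len: "arccos (v (i, s) \<bullet> v (j, t)) = a" if ij: "i \<noteq> j" for i j s t
  proof -
    obtain E where "E \<in> edges P" "E \<inter> vertices P = {v (i, s), v (j, t)}"
      using edge[OF ij] by blast
    moreover have "v (i, s) \<noteq> v (j, t)" using ij v(1) by (auto dest: injD)
    ultimately show ?thesis
      using assms(2) unfolding all_edge_lengths_def sdist_def by blast
  qed
  have inner: "v (i, s) \<bullet> v (j, t) = cos a" if "i \<noteq> j" for i j s t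
  proof -
    have "\<bar>v (i, s) \<bullet> v (j, t)\<bar> \<le> 1"
      using Cauchy_Schwarz_ineq2[of "v (i, s)" "v (j, t)"] by (simp add: unit)
    then show ?thesis using len[OF that, of s t] cos_arccos_abs by metis
  qed
  obtain e n \<mu> R where fr: "orthonormal_frame (e 1) (e 2) (e 3) n" and pos: "\<mu> > 0" "R > 0"
    and \<mu>: "\<mu>\<^sup>2 = cos a" "\<mu>\<^sup>2 * (1 + R\<^sup>2) = 1"
    and ve: "\<And>i s. v (i, s) = \<mu> *\<^sub>R (n + (sign_of s * R) *\<^sub>R e i)"
  proof (rule opposite_pairs_frame[of v "cos a"])
    show "norm (v x) = 1" for x by (rule unit)
    show "v (i, s) \<bullet> v (j, t) = cos a" if "i \<noteq> j" for i j s t by (rule inner[OF that])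
    show "v (i, True) \<noteq> v (i, False)" for i using v(1) by (auto dest: injD)
    show "v (i, True) \<noteq> - v (i, False)" for i using antipodal[OF vP] vP by metis
  qed (rule that)
  have c: "cos a > 0" using pos \<mu> by (metis zero_less_power)
  have R2: "R\<^sup>2 = 1 / cos a - 1" using \<mu> c by (simp add: field_simps)
  have a: "0 < a" "a < pi / 2"
  proof -
    have "a = arccos (v (1, True) \<bullet> v (2, True))" using len[of 1 2] by simp
    moreover have "\<bar>v (1, True) \<bullet> v (2, True)\<bar> \<le> 1"
      using Cauchy_Schwarz_ineq2[of "v (1, True)" "v (2, True)"] by (simp add: unit)
    ultimately have "0 \<le> a" "a \<le> pi"
      by (auto simp: abs_le_iff intro!: arccos_lbound arccos_ubound)
    have "R\<^sup>2 > 0" using pos by simp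
    then have "a \<noteq> 0" using R2 by auto
    with \<open>0 \<le> a\<close> show "0 < a" by simp
    show "a < pi / 2"
    proof (rule ccontr)
      assume "\<not> a < pi / 2"
      then have "cos a \<le> cos (pi / 2)"
        using \<open>a \<le> pi\<close> by (intro cos_monotone_0_pi_le) auto
      with c show False by simp
    qed
  qed
  \<comment> \<open>Which sign pattern a facet has is read off from the vertices it contains.\<close>
  have facet_eq: "\<exists>F\<in>facets P. range (\<lambda>i. v (i, s i)) = F \<inter> vertices P \<and>
      P \<subseteq> {x. x \<bullet> (sign_of (s 1) *\<^sub>R e 1) + x \<bullet> (sign_of (s 2) *\<^sub>R e 2) + x \<bullet> (sign_of (s 3) *\<^sub>R e 3) \<le> R * (x \<bullet> n)} \<and>
      F = {x \<in> P. x \<bullet> (sign_of (s 1) *\<^sub>R e 1) + x \<bullet> (sign_of (s 2) *\<^sub>R e 2) + x \<bullet> (sign_of (s 3) *\<^sub>R e 3) = R * (x \<bullet> n)}" for s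
  proof -
    obtain F where F: "F \<in> facets P" "F \<inter> vertices P = range (\<lambda>i. v (i, s i))"
      using facet by blast
    have vF: "\<mu> *\<^sub>R (n + R *\<^sub>R (sign_of (s i) *\<^sub>R e i)) \<in> F" for i
    proof -
      have "v (i, s i) \<in> F" using F(2) by blast
      then show ?thesis by (simp add: ve mult.commute)
    qed
    have "v (1, \<not> s 1) \<in> P" by (rule vP)
    then have vP': "\<mu> *\<^sub>R (n - R *\<^sub>R (sign_of (s 1) *\<^sub>R e 1)) \<in> P"
      by (cases "s 1") (simp_all add: ve)
    note halfspace = facet_halfspace[OF orthonormal_frame_signs[OF fr, of "s 1" "s 2" "s 3"] pos F(1) vF vF vF vP']
    show ?thesis
      by (intro bexI[OF _ F(1)] conjI halfspace F(2)[symmetric])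
  qed
  have "P = {x \<in> S3. \<bar>x \<bullet> e 1\<bar> + \<bar>x \<bullet> e 2\<bar> + \<bar>x \<bullet> e 3\<bar> \<le> R * (x \<bullet> n)}"
  proof (intro equalityI subsetI)
    fix x assume x: "x \<in> P"
    \<comment> \<open>The facet whose signs agree with those of the coordinates gives the inequality with absolute values.\<close>
    have "sign_of (0 \<le> r) * r = \<bar>r\<bar>" for r by (simp add: sign_of_def)
    then have "\<bar>x \<bullet> e 1\<bar> + \<bar>x \<bullet> e 2\<bar> + \<bar>x \<bullet> e 3\<bar> \<le> R * (x \<bullet> n)"
      using facet_eq[of "\<lambda>i. 0 \<le> x \<bullet> e i"] x by auto
    then show "x \<in> {x \<in> S3. \<bar>x \<bullet> e 1\<bar> + \<bar>x \<bullet> e 2\<bar> + \<bar>x \<bullet> e 3\<bar> \<le> R * (x \<bullet> n)}"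
      using x U(2) by simp
  next
    fix x assume x: "x \<in> {x \<in> S3. \<bar>x \<bullet> e 1\<bar> + \<bar>x \<bullet> e 2\<bar> + \<bar>x \<bullet> e 3\<bar> \<le> R * (x \<bullet> n)}"
    have "u \<bullet> x \<ge> 0" if u: "u \<in> U" for u
    proof (rule octahedral_region_subset_hemisphere[OF fr pos])
      have "0 \<le> u \<bullet> v (i, s)" for i s
        using vP[of "(i, s)"] u unfolding U(2) by (auto simp: shemisphere_def)
      from this[of _ True] this[of _ False]
      show "0 \<le> u \<bullet> (\<mu> *\<^sub>R (n + R *\<^sub>R w))" if "w \<in> {e 1, - e 1, e 2, - e 2, e 3, - e 3}" for w
        using that by (auto simp: ve)
    qed (use x in simp)
    then show "x \<in> P" using x unfolding U(2) by (auto simp: shemisphere_def)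
  qed
  from svol_octahedron[OF fr pos(2) this]
  have vol: "svol P = 192 * integral {0..sqrt ((1 / cos a - 1) / 3)} orthoscheme_density"
    using pos by (simp add: real_sqrt_divide flip: R2)
  have "A = arccos (- 1 / (1 + 2 * cos a))"
  proof -
    \<comment> \<open>One edge suffices: the facets on its two sides differ in the vertex of the third pair.\<close>
    obtain E where E: "E \<in> edges P" "E \<inter> vertices P = {v (1, True), v (2, True)}"
      using edge[of 1 2 True True] by auto
    obtain F where F: "F \<in> facets P" "range (\<lambda>i. v (i, True)) = F \<inter> vertices P"
      "P \<subseteq> {x. x \<bullet> e 1 + x \<bullet> e 2 + x \<bullet> e 3 \<le> R * (x \<bullet> n)}"
      "F = {x \<in> P. x \<bullet> e 1 + x \<bullet> e 2 + x \<bullet> e 3 = R * (x \<bullet> n)}"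
      using facet_eq[of "\<lambda>_. True"] by auto
    obtain G where G: "G \<in> facets P" "range (\<lambda>i. v (i, i \<noteq> 3)) = G \<inter> vertices P"
      "P \<subseteq> {x. x \<bullet> e 1 + x \<bullet> e 2 + x \<bullet> (- e 3) \<le> R * (x \<bullet> n)}"
      "G = {x \<in> P. x \<bullet> e 1 + x \<bullet> e 2 + x \<bullet> (- e 3) = R * (x \<bullet> n)}"
      using facet_eq[of "\<lambda>i. i \<noteq> 3"] by auto
    have v1: "v (1, True) = \<mu> *\<^sub>R (n + R *\<^sub>R e 1)" and v2: "v (2, True) = \<mu> *\<^sub>R (n + R *\<^sub>R e 2)"
      and v3: "v (3, True) = \<mu> *\<^sub>R (n + R *\<^sub>R e 3)" and v3': "v (3, False) = \<mu> *\<^sub>R (n + R *\<^sub>R (- e 3))"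
      by (simp_all add: ve)
    have vE: "v (1, True) \<in> E" "v (2, True) \<in> E" using E(2) by auto
    have EP: "E \<subseteq> P" using E(1) by (auto simp: edges_def spherical_face_def)
    have span: "E \<subseteq> span {v (1, True), v (2, True)}"
    proof (rule card_ge_dim_independent)
      show "{v (1, True), v (2, True)} \<subseteq> E" using vE by simp
      have ne: "v (1, True) \<noteq> v (2, True)" using v(1) by (auto dest: injD)
      have "v (1, True) \<notin> span {v (2, True)}"
      proof
        assume "v (1, True) \<in> span {v (2, True)}"
        then obtain k where k: "v (1, True) = k *\<^sub>R v (2, True)" by (auto simp: span_singleton)
        then have "v (1, True) \<bullet> e 1 = k *\<^sub>R v (2, True) \<bullet> e 1" by simp
        then show False
          using fr pos by (simp add: v1 v2 orthonormal_frame_def inner_simps inner_commute)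
      qed
      moreover have "v (2, True) \<noteq> 0" using unit[of "(2, True)"] by auto
      ultimately show "independent {v (1, True), v (2, True)}"
        using ne by (simp add: independent_insert)
      show "dim E \<le> card {v (1, True), v (2, True)}"
        using E(1) ne by (simp add: edges_def)
    qed
    have Eplane: "x \<bullet> e 3 = 0 \<and> x \<bullet> e 1 + x \<bullet> e 2 = R * (x \<bullet> n)" if "x \<in> E" for x
    proof -
      have "span {v (1, True), v (2, True)} \<subseteq> {x. x \<bullet> e 3 = 0 \<and> x \<bullet> e 1 + x \<bullet> e 2 = R * (x \<bullet> n)}"
      proof (rule span_minimal)
        show "{v (1, True), v (2, True)} \<subseteq> {x. x \<bullet> e 3 = 0 \<and> x \<bullet> e 1 + x \<bullet> e 2 = R * (x \<bullet> n)}"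
          using fr by (auto simp: v1 v2 orthonormal_frame_def inner_simps inner_commute)
        show "subspace {x. x \<bullet> e 3 = 0 \<and> x \<bullet> e 1 + x \<bullet> e 2 = R * (x \<bullet> n)}"
        proof -
          have "{x. x \<bullet> e 3 = 0 \<and> x \<bullet> e 1 + x \<bullet> e 2 = R * (x \<bullet> n)} =
              {x. x \<bullet> e 3 = 0} \<inter> {x. x \<bullet> (e 1 + e 2 - R *\<^sub>R n) = 0}"
            by (auto simp: inner_simps)
          then show ?thesis by (simp only: subspace_inter subspace_hyperplane2)
        qed
      qed
      with span that show ?thesis by blast
    qed
    have EF: "E \<subseteq> F" and EG: "E \<subseteq> G"
      using EP Eplane unfolding F(4) G(4) by auto
    have "v (3, True) \<in> F" using F(2) by blast
    have "v (3, False) \<in> G"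
    proof -
      have "v (3, 3 \<noteq> (3::3)) \<in> G" using G(2) by blast
      then show ?thesis by simp
    qed
    have "F \<noteq> G"
    proof
      assume "F = G"
      then have "v (3, True) \<in> G" using \<open>v (3, True) \<in> F\<close> by simp
      then show False
        using fr pos unfolding G(4) by (simp add: v3 orthonormal_frame_def inner_simps inner_commute)
    qed
    then have "A = dihedral_angle E F G"
      using assms(3) E(1) F(1) G(1) EF EG unfolding all_dihedral_angles_def by blast
    also have "\<dots> = arccos (- ((R\<^sup>2 + 1) / (R\<^sup>2 + 3)))"
    proof (rule dihedral_angle_value[OF fr pos(2)]; rule inward_conormal_eq[where \<mu> = \<mu>, OF _ pos(2)])
      show "orthonormal_frame (e 1) (e 2) (e 3) n" by (rule fr)
      show "orthonormal_frame (e 1) (e 2) (- e 3) n" using fr by (rule orthonormal_frame_minus)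
      show "0 \<le> x \<bullet> e 3" if "x \<in> F" for x
        using that G(3) unfolding F(4) by auto
      show "0 \<le> x \<bullet> (- e 3)" if "x \<in> G" for x
        using that F(3) unfolding G(4) by auto
      show "x \<bullet> e 1 + x \<bullet> e 2 + x \<bullet> e 3 = R * (x \<bullet> n)" if "x \<in> F" for x
        using that unfolding F(4) by auto
      show "x \<bullet> e 1 + x \<bullet> e 2 + x \<bullet> (- e 3) = R * (x \<bullet> n)" if "x \<in> G" for x
        using that unfolding G(4) by auto
    qed (rule pos(1) EF EG vE[unfolded v1 v2] span[unfolded v1 v2]
        \<open>v (3, True) \<in> F\<close>[unfolded v3] \<open>v (3, False) \<in> G\<close>[unfolded v3'])+
    also have "- ((R\<^sup>2 + 1) / (R\<^sup>2 + 3)) = - 1 / (1 + 2 * cos a)"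
    proof -
      have "R\<^sup>2 + 1 = 1 / cos a" "R\<^sup>2 + 3 = (1 + 2 * cos a) / cos a"
        using c by (simp_all add: R2 field_simps)
      then show ?thesis using c by simp
    qed
    finally show ?thesis .
  qed
  then show ?thesis
    using integral_unique[OF integral_orthoscheme_density[OF a]]
      integral_unique[OF integral_over_dihedral_angle[OF a]] vol
    by simp
qed

end
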